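(* Let $\nu>-1$ be real and let $j_{\nu,n}$ denote the $n$th positive zero of the Bessel function of the first kind $J_\nu$. Then for every $k\in\{1,2,\dots\}$, $$\sum_{n\geq 1,\ n\neq k}\frac{1}{j_{\nu,n}^4-j_{\nu,k}^4}=-\frac{1}{2j_{\nu,k}^2}\sum_{n\geq 1}\frac{1}{j_{\nu,n}^2+j_{\nu,k}^2}+\frac{\nu+2}{4j_{\nu,k}^4}.$$ In particular, for every $k\in\{1,2,\dots\}$, $$\sum_{n\geq 1,\ n\neq k}\frac{1}{n^4-k^4}=-\frac{\pi}{4k^3}\coth(k\pi)+\frac{7}{8k^4}.$$ Moreover, for every odd positive integer $k\in\{1,3,\dots\}$, $$\sum_{\substack{n\geq 1,\ n\neq k\\ n\text{ odd}}}\frac{1}{n^4-k^4}=-\frac{\pi}{8k^3}\tanh\left(\frac{k\pi}{2}\right)+\frac{3}{8k^4}.$$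
   Context: $J_\nu$ is the Bessel function of the first kind of order $\nu$, $J_\nu(x)=\sum_{m\ge 0}\frac{(-1)^m (x/2)^{2m+\nu}}{m!\,\Gamma(m+\nu+1)}$ for $x>0$. For $\nu>-1$ its positive zeros form an infinite increasing sequence $0<j_{\nu,1}<j_{\nu,2}<\cdots$. All sums are over integers $n$. *)

theory Defs
  imports "HOL-Analysis.Analysis"
begin

(* Only meaningful for x > 0, because of the real power. *)
definition bessel_J :: "real \<Rightarrow> real \<Rightarrow> real" where
  "bessel_J \<nu> x =
     (\<Sum>m. (-1) ^ m * (x / 2) powr (2 * real m + \<nu>) / (fact m * Gamma (real m + \<nu> + 1)))"

(* Indexed from n = 1: the n-th positive zero is the positive zero x such that there are exactly
   n zeros in the interval from 0 (excluded) to x (included). The value at n = 0 is arbitrary. *)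
definition bessel_J_zero :: "real \<Rightarrow> nat \<Rightarrow> real" where
  "bessel_J_zero \<nu> n =
     (THE x. x > 0 \<and> bessel_J \<nu> x = 0 \<and> card {y. 0 < y \<and> y \<le> x \<and> bessel_J \<nu> y = 0} = n)"

definition coth :: "real \<Rightarrow> real" where
  "coth x = cosh x / sinh x"

end

theory Submission
  imports Defs "HOL-Complex_Analysis.Complex_Analysis"
    "HOL-Computational_Algebra.Fundamental_Theorem_Algebra"
begin

text \<open>
  Put \<open>\<alpha> = \<nu> + 1\<close> and write \<open>J\<^sub>\<nu>(x) = c x\<^sup>\<nu> F(x\<^sup>2)\<close> with \<open>F\<close> entire and \<open>4 w F'' + 4 \<alpha> F' + F = 0\<close>.
  \<open>F\<close> is a pointwise limit (with derivatives) of rescaled Laguerre polynomials, which have only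
  positive roots, with reciprocals summing to \<open>1 / (4 \<alpha>)\<close>. This gives
  \<open>\<bar>F'(w)\<bar> \<bar>Im w\<bar> \<le> \<bar>w\<bar> \<bar>F(w)\<bar> / (4 \<alpha>)\<close>; hence the zeros \<open>a\<close> of \<open>F\<close> are positive and simple, and
  \<open>\<Sum> 1 / a\<close> converges. The same bound makes \<open>F'/F - \<Sum> 1 / (w - a)\<close> constant by a Liouville argument,
  and the constant vanishes by the behaviour at \<open>-\<infinity>\<close>. Evaluating at \<open>w = -b\<close>, and at a zero \<open>w = b\<close>
  after removal of the pole, where the regular part of \<open>F'/F\<close> is \<open>F''(b) / (2 F'(b)) = -\<alpha> / (2 b)\<close>,
  and using \<open>1 / (a\<^sup>2 - b\<^sup>2) = (1 / (a - b) - 1 / (a + b)) / (2 b)\<close> yields the first identity.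
  The other two are the cases \<open>\<nu> = 1/2\<close> and \<open>\<nu> = -1/2\<close>, where \<open>F(x\<^sup>2)\<close> is \<open>sin x / x\<close> and \<open>cos x\<close>.
\<close>

subsection \<open>The entire function attached to the Bessel function\<close>

text \<open>Taylor coefficients in w of the hypergeometric function
  \<open>0F1(; \<alpha>; - w / 4)\<close>.\<close>

definition bcoef :: "real \<Rightarrow> nat \<Rightarrow> real" where
  "bcoef \<alpha> j = (-1/4) ^ j / (fact j * pochhammer \<alpha> j)"

text \<open>With \<open>\<alpha> = \<nu> + 1\<close>, \<open>bfun \<alpha> (x\<^sup>2)\<close> is \<open>\<Gamma>(\<alpha>) (x/2)\<^bsup>-\<nu>\<^esup> J\<^sub>\<nu>(x)\<close>.\<close>

definition bfun :: "real \<Rightarrow> complex \<Rightarrow> complex" where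
  "bfun \<alpha> w = (\<Sum>j. of_real (bcoef \<alpha> j) * w ^ j)"

lemma power_le_pochhammer:
  assumes "\<alpha> > (0::real)"
  shows "\<alpha> ^ j \<le> pochhammer \<alpha> j"
proof (induction j)
  case (Suc j)
  have "\<alpha> ^ j * \<alpha> \<le> pochhammer \<alpha> j * (\<alpha> + real j)"
    using Suc assms by (intro mult_mono) (auto intro: order.trans[of _ "\<alpha> ^ j"])
  then show ?case by (simp add: pochhammer_Suc mult.commute)
qed simp

lemma abs_bcoef_le:
  assumes "\<alpha> > 0"
  shows "\<bar>bcoef \<alpha> j\<bar> \<le> (1 / (4 * \<alpha>)) ^ j / fact j"
proof -
  have "\<bar>bcoef \<alpha> j\<bar> = (1/4) ^ j / (fact j * pochhammer \<alpha> j)"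
    using assms by (simp add: bcoef_def abs_mult power_abs pochhammer_nonneg)
  also have "\<dots> \<le> (1/4) ^ j / (fact j * \<alpha> ^ j)"
    using assms power_le_pochhammer[OF assms, of j] by (intro divide_left_mono mult_left_mono) (auto intro!: mult_pos_pos pochhammer_pos)
  also have "\<dots> = (1 / (4 * \<alpha>)) ^ j / fact j"
    by (simp add: power_divide power_mult_distrib)
  finally show ?thesis .
qed

lemma bcoef_Suc:
  assumes "\<alpha> > 0"
  shows "real (Suc j) * bcoef \<alpha> (Suc j) = - bcoef (\<alpha> + 1) j / (4 * \<alpha>)"
proof -
  have "pochhammer (\<alpha> + 1) j > 0" using assms by (intro pochhammer_pos) simp
  then show ?thesis using assms
    by (simp add: bcoef_def pochhammer_rec field_simps del: of_nat_Suc)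
qed

lemma summable_abs_bcoef:
  assumes "\<alpha> > 0"
  shows "summable (\<lambda>j. \<bar>bcoef \<alpha> j\<bar> * x ^ j)"
proof (rule summable_comparison_test')
  have "summable (\<lambda>j. (1 / (4 * \<alpha>) * \<bar>x\<bar>) ^ j /\<^sub>R fact j)"
    by (rule summable_exp_generic)
  then show "summable (\<lambda>j. (1 / (4 * \<alpha>)) ^ j / fact j * \<bar>x\<bar> ^ j)"
    by (simp add: power_mult_distrib field_simps)
  show "norm (\<bar>bcoef \<alpha> j\<bar> * x ^ j) \<le> (1 / (4 * \<alpha>)) ^ j / fact j * \<bar>x\<bar> ^ j" for j
    using mult_right_mono[OF abs_bcoef_le[OF assms, of j], of "\<bar>x\<bar> ^ j"] by (simp add: abs_mult power_abs)
qed

lemma summable_bfun: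
  fixes w :: complex
  assumes "\<alpha> > 0"
  shows "summable (\<lambda>j. of_real (bcoef \<alpha> j) * w ^ j)"
  by (rule summable_norm_cancel)
     (use summable_abs_bcoef[OF assms, of "norm w"] in \<open>simp add: norm_mult norm_power\<close>)

text \<open>Termwise differentiation only raises the parameter: the factor \<open>j + 1\<close>
  cancels in the factorial and the Pochhammer symbol sheds its first factor \<alpha>.\<close>

lemma DERIV_bfun:
  assumes "\<alpha> > 0"
  shows "(bfun \<alpha> has_field_derivative - bfun (\<alpha> + 1) w / (4 * of_real \<alpha>)) (at w)"
proof -
  have d: "diffs (\<lambda>j. of_real (bcoef \<alpha> j) :: complex) j = - (1 / (4 * of_real \<alpha>)) * of_real (bcoef (\<alpha> + 1) j)" for j
  proof -
    have "diffs (\<lambda>j. of_real (bcoef \<alpha> j) :: complex) j = of_real (real (Suc j) * bcoef \<alpha> (Suc j))"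
      by (simp add: diffs_def)
    then show ?thesis by (simp only: bcoef_Suc[OF assms]) simp
  qed
  have "(bfun \<alpha> has_field_derivative (\<Sum>j. diffs (\<lambda>j. of_real (bcoef \<alpha> j)) j * w ^ j)) (at w)"
    unfolding bfun_def[abs_def] by (rule termdiffs_strong_converges_everywhere[OF summable_bfun[OF assms]])
  also have "(\<Sum>j. diffs (\<lambda>j. of_real (bcoef \<alpha> j)) j * w ^ j) = - bfun (\<alpha> + 1) w / (4 * of_real \<alpha>)"
    unfolding d bfun_def mult.assoc using assms
    by (subst suminf_mult) (simp_all add: summable_bfun)
  finally show ?thesis .
qed

lemma holomorphic_bfun:
  assumes "\<alpha> > 0"
  shows "bfun \<alpha> holomorphic_on A"
  using DERIV_bfun[OF assms] by (auto simp: holomorphic_on_def field_differentiable_def intro: DERIV_subset)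

lemma bfun_0 [simp]: "bfun \<alpha> 0 = 1"
  unfolding bfun_def using powser_zero[of "\<lambda>j. of_real (bcoef \<alpha> j) :: complex"]
  by (simp add: bcoef_def)

lemma bcoef_contiguous:
  assumes "\<alpha> > 0"
  shows "bcoef (\<alpha> + 1) (Suc j) - bcoef \<alpha> (Suc j) = bcoef (\<alpha> + 2) j / (4 * \<alpha> * (\<alpha> + 1))"
proof -
  define p where "p = pochhammer (\<alpha> + 1 + 1) j"
  have p: "p > 0" using assms by (auto simp: p_def intro!: pochhammer_pos)
  have e: "pochhammer \<alpha> (Suc j) = \<alpha> * pochhammer (\<alpha> + 1) j"
    by (simp add: pochhammer_rec)
  have e2: "pochhammer (\<alpha> + 1) (Suc j) = (\<alpha> + 1) * p"
    by (simp add: pochhammer_rec p_def)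
  have e3: "pochhammer (\<alpha> + 1) (Suc j) = pochhammer (\<alpha> + 1) j * (\<alpha> + 1 + real j)"
    by (simp add: pochhammer_Suc)
  have e4: "pochhammer (\<alpha> + 1) j = (\<alpha> + 1) * p / (\<alpha> + 1 + real j)"
    using e2 e3 assms by (simp add: field_simps)
  have 2: "\<alpha> + 2 = \<alpha> + 1 + 1" by simp
  have nz: "\<alpha> + 1 + real j \<noteq> 0" "\<alpha> + 1 \<noteq> 0" "\<alpha> \<noteq> 0" using assms by auto
  show ?thesis
    unfolding bcoef_def e e2 2 p_def[symmetric] unfolding e4
    using nz p by (simp add: divide_simps) (simp add: algebra_simps)
qed

text \<open>Read together with \<open>DERIV_bfun\<close>, this is the differential equation
  \<open>4 w F'' + 4 \<alpha> F' + F = 0\<close>.\<close>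

lemma bfun_contiguous:
  assumes "\<alpha> > 0"
  shows "bfun (\<alpha> + 1) w - bfun \<alpha> w = w * bfun (\<alpha> + 2) w / (4 * of_real \<alpha> * (of_real \<alpha> + 1))"
proof -
  have s: "summable (\<lambda>j. of_real (bcoef (\<alpha>+1) j) * w ^ j)" "summable (\<lambda>j. of_real (bcoef \<alpha> j) * w ^ j)"
    "summable (\<lambda>j. of_real (bcoef (\<alpha> + 2) j) * w ^ j)"
    using assms by (auto intro!: summable_bfun)
  have "bfun (\<alpha> + 1) w - bfun \<alpha> w = (\<Sum>j. of_real (bcoef (\<alpha>+1) j) * w ^ j - of_real (bcoef \<alpha> j) * w ^ j)"
    unfolding bfun_def by (rule suminf_diff[OF s(1,2)])
  also have "\<dots> = (\<Sum>j. of_real (bcoef (\<alpha>+1) (Suc j)) * w ^ Suc j - of_real (bcoef \<alpha> (Suc j)) * w ^ Suc j)"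
    using suminf_split_head[OF summable_diff[OF s(1,2)]] by (simp add: bcoef_def)
  also have "\<dots> = (\<Sum>j. w / (4 * of_real \<alpha> * (of_real \<alpha> + 1)) * (of_real (bcoef (\<alpha> + 2) j) * w ^ j))"
  proof (intro suminf_cong)
    fix j
    have "of_real (bcoef (\<alpha>+1) (Suc j)) * w ^ Suc j - of_real (bcoef \<alpha> (Suc j)) * w ^ Suc j
      = of_real (bcoef (\<alpha>+1) (Suc j) - bcoef \<alpha> (Suc j)) * w ^ Suc j"
      by (simp add: left_diff_distrib del: power_Suc)
    then show "of_real (bcoef (\<alpha>+1) (Suc j)) * w ^ Suc j - of_real (bcoef \<alpha> (Suc j)) * w ^ Suc j
      = w / (4 * of_real \<alpha> * (of_real \<alpha> + 1)) * (of_real (bcoef (\<alpha> + 2) j) * w ^ j)"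
      by (simp only: bcoef_contiguous[OF assms]) simp
  qed
  also have "\<dots> = w / (4 * of_real \<alpha> * (of_real \<alpha> + 1)) * bfun (\<alpha> + 2) w"
    unfolding bfun_def by (rule suminf_mult[OF s(3)])
  finally show ?thesis by simp
qed

subsection \<open>Approximation by polynomials with positive roots\<close>

text \<open>\<open>laguerre n \<alpha>\<close> is \<open>n!\<close> times the classical Laguerre polynomial with upper index \<open>\<alpha> - 1\<close>.\<close>

fun laguerre :: "nat \<Rightarrow> real \<Rightarrow> complex poly" where
  "laguerre 0 \<alpha> = 1"
| "laguerre (Suc n) \<alpha> = [:of_real \<alpha>, -1:] * laguerre n (\<alpha> + 1) + [:0, 1:] * pderiv (laguerre n (\<alpha> + 1))"

text \<open>In the recursion the factor \<open>\<alpha> + j\<close> is prepended to the Pochhammer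
  symbol of the coefficient of index j; both contributions then carry the same symbol, and Pascal's
  rule adds the binomials.\<close>

lemma coeff_laguerre:
  "coeff (laguerre n \<alpha>) j = of_real ((-1) ^ j * of_nat (n choose j) * pochhammer (\<alpha> + of_nat j) (n - j))"
proof (induction n arbitrary: \<alpha> j)
  case 0
  show ?case by (cases j) auto
next
  case (Suc n)
  show ?case
  proof (cases j)
    case 0
    then show ?thesis by (simp add: Suc pochhammer_rec)
  next
    case (Suc i)
    have c: "coeff (laguerre (Suc n) \<alpha>) j = (of_real \<alpha> + of_nat (Suc i)) * coeff (laguerre n (\<alpha> + 1)) (Suc i) - coeff (laguerre n (\<alpha> + 1)) i"
      by (simp add: Suc coeff_pderiv algebra_simps)
    show ?thesis
    proof (cases "n \<ge> Suc i")
      case True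
      then have nS: "n - i = Suc (n - Suc i)" by simp
      have p: "pochhammer (\<alpha> + of_nat (Suc i)) (n - i) = (\<alpha> + of_nat (Suc i)) * pochhammer (\<alpha> + 1 + of_nat (Suc i)) (n - Suc i)"
        unfolding nS by (simp add: pochhammer_rec add_ac)
      have "coeff (laguerre (Suc n) \<alpha>) j = of_real ((-1) ^ Suc i * (of_nat (n choose Suc i) * pochhammer (\<alpha> + of_nat (Suc i)) (n - i)
          + of_nat (n choose i) * pochhammer (\<alpha> + of_nat (Suc i)) (n - i)))"
        unfolding c Suc.IH p
        using p by (simp add: algebra_simps)
      then show ?thesis unfolding Suc by (simp add: algebra_simps)
    next
      case False
      then have z: "n choose Suc i = 0" by simp
      have "pochhammer (\<alpha> + 1 + of_nat i) (n - i) = pochhammer (\<alpha> + of_nat (Suc i)) (n - i)"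
        by (simp add: algebra_simps)
      then show ?thesis unfolding c Suc.IH unfolding Suc binomial_Suc_Suc z by simp
    qed
  qed
qed

lemma has_field_derivative_prod_linear:
  fixes r :: "'i \<Rightarrow> complex"
  assumes "finite I" "\<And>i. i \<in> I \<Longrightarrow> w \<noteq> r i"
  shows "((\<lambda>z. \<Prod>i\<in>I. (z - r i)) has_field_derivative (\<Prod>i\<in>I. (w - r i)) * (\<Sum>i\<in>I. 1 / (w - r i))) (at w)"
  using assms
proof (induction I rule: finite_induct)
  case (insert x I)
  have "((\<lambda>z. (z - r x) * (\<Prod>i\<in>I. (z - r i))) has_field_derivative
     1 * (\<Prod>i\<in>I. (w - r i)) + (\<Prod>i\<in>I. (w - r i)) * (\<Sum>i\<in>I. 1 / (w - r i)) * (w - r x)) (at w)"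
    using insert by (intro DERIV_mult) (auto intro!: derivative_eq_intros)
  moreover have "1 * (\<Prod>i\<in>I. (w - r i)) + (\<Prod>i\<in>I. (w - r i)) * (\<Sum>i\<in>I. 1 / (w - r i)) * (w - r x)
     = (\<Prod>i\<in>insert x I. (w - r i)) * (\<Sum>i\<in>insert x I. 1 / (w - r i))"
    using insert by (simp add: field_simps)
  ultimately show ?case using insert by simp
qed simp

lemma complex_poly_decompose_of_real:
  fixes p :: "complex poly"
  assumes "\<And>w. poly p w = 0 \<Longrightarrow> w \<in> of_real ` {0<..}"
  obtains r :: "nat \<Rightarrow> real" where "\<And>i. i < degree p \<Longrightarrow> r i > 0"
    "\<And>w. poly p w = lead_coeff p * (\<Prod>i<degree p. (w - of_real (r i)))"
proof -
  obtain root where root: "smult (lead_coeff p) (\<Prod>i<degree p. [:-root i, 1:]) = p"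
    using complex_poly_decompose'[of p] by blast
  have e: "poly p w = lead_coeff p * (\<Prod>i<degree p. (w - root i))" for w
    by (subst root[symmetric]) (simp add: poly_prod)
  have "root i \<in> of_real ` {0<..}" if "i < degree p" for i
    using that by (intro assms) (auto simp: e)
  then have "\<forall>i. \<exists>x. i < degree p \<longrightarrow> root i = complex_of_real x \<and> x > 0"
    by blast
  then obtain r where r: "\<And>i. i < degree p \<Longrightarrow> root i = of_real (r i) \<and> r i > 0" by metis
  show ?thesis
  proof (rule that[of r])
    show "poly p w = lead_coeff p * (\<Prod>i<degree p. (w - of_real (r i)))" for w
      unfolding e using r by (intro arg_cong2[where f = "(*)"] prod.cong) auto
  qed (use r in auto)
qed

text \<open>If the roots \<open>r\<^sub>i\<close> of \<open>p\<close> are positive and \<open>p w \<noteq> 0\<close>, the next polynomial at \<open>w\<close> is \<open>p w\<close>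
  times \<open>\<alpha> - w + \<Sum> w / (w - r\<^sub>i)\<close>, whose imaginary part has the sign opposite to that of \<open>Im w\<close>, and
  which is positive for real \<open>w \<le> 0\<close>.\<close>

lemma laguerre_roots_positive:
  assumes "\<alpha> > 0" "poly (laguerre n \<alpha>) w = 0"
  shows "w \<in> of_real ` {0<..}"
  using assms
proof (induction n arbitrary: \<alpha> w)
  case (Suc n)
  define p where "p = laguerre n (\<alpha> + 1)"
  have pos: "\<alpha> + 1 > 0" using Suc.prems by simp
  have pr: "w \<in> of_real ` {0<..}" if "poly p w = 0" for w
    using that Suc.IH[OF pos, of w] by (simp add: p_def)
  show ?case
  proof (cases "poly p w = 0")
    case True
    then show ?thesis by (rule pr)
  next
    case False
    obtain r where r: "\<And>i. i < degree p \<Longrightarrow> r i > (0::real)"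
      "\<And>w. poly p w = lead_coeff p * (\<Prod>i<degree p. (w - of_real (r i)))"
      using complex_poly_decompose_of_real[OF pr] by blast
    have ne: "w \<noteq> of_real (r i)" if "i < degree p" for i
    proof
      assume "w = of_real (r i)"
      then have "(\<Prod>i<degree p. (w - of_real (r i))) = 0" using that by auto
      with False r(2)[of w] show False by simp
    qed
    have "((\<lambda>w. lead_coeff p * (\<Prod>i<degree p. (w - of_real (r i)))) has_field_derivative
        lead_coeff p * ((\<Prod>i<degree p. (w - of_real (r i))) * (\<Sum>i<degree p. 1 / (w - of_real (r i))))) (at w)"
      by (intro DERIV_cmult has_field_derivative_prod_linear) (use ne in auto)
    then have "(poly p has_field_derivative poly p w * (\<Sum>i<degree p. 1 / (w - of_real (r i)))) (at w)"
      unfolding mult.assoc[symmetric] r(2)[symmetric] .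
    with poly_DERIV have pd: "poly (pderiv p) w = poly p w * (\<Sum>i<degree p. 1 / (w - of_real (r i)))"
      by (rule DERIV_unique)
    have "poly p w * (of_real \<alpha> - w + w * (\<Sum>i<degree p. 1 / (w - of_real (r i)))) = 0"
      using Suc.prems(2) pd unfolding laguerre.simps p_def[symmetric] by (simp add: algebra_simps)
    with False have z: "of_real \<alpha> - w + (\<Sum>i<degree p. w / (w - of_real (r i))) = 0"
      by (simp add: sum_distrib_left)
    have im: "Im (w / (w - of_real a)) = - (a / (cmod (w - of_real a))\<^sup>2) * Im w" for a
      by (simp add: Im_divide cmod_power2 divide_simps) (simp add: algebra_simps)
    have "0 = Im (of_real \<alpha> - w + (\<Sum>i<degree p. w / (w - of_real (r i))))" unfolding z by simp
    also have "\<dots> = - (1 + (\<Sum>i<degree p. r i / (cmod (w - of_real (r i)))\<^sup>2)) * Im w"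
      by (simp add: im sum_negf) (simp add: algebra_simps sum_distrib_left)
    finally have "(1 + (\<Sum>i<degree p. r i / (cmod (w - of_real (r i)))\<^sup>2)) * Im w = 0"
      by (metis minus_mult_left neg_equal_0_iff_equal)
    moreover have "(\<Sum>i<degree p. r i / (cmod (w - of_real (r i)))\<^sup>2) \<ge> 0"
      using r(1) by (intro sum_nonneg divide_nonneg_nonneg) (auto intro: less_imp_le)
    ultimately have iw: "Im w = 0" by auto
    then have w: "w = of_real (Re w)" by (simp add: complex_eq_iff)
    show ?thesis
    proof (cases "Re w > 0")
      case True
      with w show ?thesis by (metis greaterThan_iff imageI)
    next
      case False
      have "0 = Re (of_real \<alpha> - w + (\<Sum>i<degree p. w / (w - of_real (r i))))" unfolding z by simp
      also have "\<dots> = \<alpha> - Re w + (\<Sum>i<degree p. Re (w / (w - of_real (r i))))" by simp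
      also have "(\<Sum>i<degree p. Re (w / (w - of_real (r i)))) = (\<Sum>i<degree p. Re w / (Re w - r i))"
        by (subst (1 2) w) (simp flip: of_real_diff of_real_divide)
      finally have "\<alpha> - Re w + (\<Sum>i<degree p. Re w / (Re w - r i)) = 0" by simp
      moreover have "(\<Sum>i<degree p. Re w / (Re w - r i)) \<ge> 0"
        using r(1) False by (intro sum_nonneg divide_nonpos_nonpos) force+
      ultimately show ?thesis using Suc.prems(1) False by linarith
    qed
  qed
qed auto

section \<open>Rescaled Laguerre polynomials and their limit\<close>

definition falling_ratio :: "nat \<Rightarrow> nat \<Rightarrow> real" where
  "falling_ratio n j = real (n choose j) * fact j / real n ^ j"

lemma falling_ratio_nonneg: "falling_ratio n j \<ge> 0"
  by (simp add: falling_ratio_def)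

lemma falling_ratio_le_1: "falling_ratio n j \<le> 1"
proof -
  have "real (n choose j) * fact j \<le> real n ^ j"
    using binomial_fact_pow[of n j] by (metis of_nat_fact of_nat_le_iff of_nat_mult of_nat_power)
  then show ?thesis by (cases "real n ^ j = 0") (auto simp: falling_ratio_def divide_le_eq_1)
qed

text \<open>The ratio is \<open>n (n - 1) ... (n - j + 1) / n^j\<close>; for n > j, passing from j
  to j + 1 multiplies it by \<open>1 - j / n\<close>, which tends to 1.\<close>

lemma falling_ratio_LIMSEQ: "(\<lambda>n. falling_ratio n j) \<longlonglongrightarrow> 1"
proof (induction j)
  case 0
  then show ?case by (simp add: falling_ratio_def)
next
  case (Suc j)
  have "(\<lambda>n. falling_ratio n j * (1 - real j * (1 / real n))) \<longlonglongrightarrow> 1 * (1 - real j * 0)"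
    by (intro tendsto_intros Suc lim_1_over_n)
  moreover have "eventually (\<lambda>n. falling_ratio n j * (1 - real j * (1 / real n)) = falling_ratio n (Suc j)) sequentially"
    using eventually_gt_at_top[of j]
  proof eventually_elim
    case (elim n)
    have "Suc j * (n choose Suc j) = (n - j) * (n choose j)"
      by (metis binomial_absorb_comp binomial_absorption mult.commute)
    then have "real (Suc j) * real (n choose Suc j) = (real n - real j) * real (n choose j)"
      using elim by (metis of_nat_diff of_nat_mult less_imp_le)
    then have "real (n choose Suc j) * fact (Suc j) = (real n - real j) * (real (n choose j) * fact j)"
      by (metis (no_types, opaque_lifting) fact_Suc mult.assoc mult.commute of_nat_fact of_nat_mult)
    then show ?case using elim by (simp add: falling_ratio_def field_simps)
  qed
  ultimately show ?case by (simp add: Lim_transform_eventually)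
qed

definition bapprox_coef :: "real \<Rightarrow> nat \<Rightarrow> nat \<Rightarrow> complex" where
  "bapprox_coef \<alpha> n j = of_real (falling_ratio n j * bcoef \<alpha> j)"

text \<open>Kept as an infinite series although the terms with j > n vanish, so that the limit in n
  is an instance of Tannery's theorem.\<close>

definition bapprox :: "real \<Rightarrow> nat \<Rightarrow> complex \<Rightarrow> complex" where
  "bapprox \<alpha> n w = (\<Sum>j. bapprox_coef \<alpha> n j * w ^ j)"

definition bapprox' :: "real \<Rightarrow> nat \<Rightarrow> complex \<Rightarrow> complex" where
  "bapprox' \<alpha> n w = (\<Sum>j. diffs (bapprox_coef \<alpha> n) j * w ^ j)"

lemma norm_bapprox_coef_le: "norm (bapprox_coef \<alpha> n j) \<le> \<bar>bcoef \<alpha> j\<bar>"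
proof -
  have "falling_ratio n j * \<bar>bcoef \<alpha> j\<bar> \<le> 1 * \<bar>bcoef \<alpha> j\<bar>"
    by (rule mult_right_mono[OF falling_ratio_le_1]) simp
  then show ?thesis unfolding bapprox_coef_def norm_of_real
    by (simp add: abs_mult falling_ratio_nonneg)
qed

lemma summable_bapprox:
  assumes "\<alpha> > 0"
  shows "summable (\<lambda>j. bapprox_coef \<alpha> n j * w ^ j)"
  by (rule summable_comparison_test'[OF summable_abs_bcoef[OF assms, of "norm w"], of 0])
     (auto simp: norm_mult norm_power intro!: mult_right_mono norm_bapprox_coef_le)

lemma DERIV_bapprox:
  assumes "\<alpha> > 0"
  shows "(bapprox \<alpha> n has_field_derivative bapprox' \<alpha> n w) (at w)"
  unfolding bapprox_def[abs_def] bapprox'_def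
  by (rule termdiffs_strong_converges_everywhere[OF summable_bapprox[OF assms]])

lemma bapprox_LIMSEQ:
  assumes "\<alpha> > 0"
  shows "(\<lambda>n. bapprox \<alpha> n w) \<longlonglongrightarrow> bfun \<alpha> w"
  unfolding bapprox_def bfun_def
proof (rule conjunct2[OF conjunct2[OF tannerys_theorem]])
  show "(\<lambda>n. bapprox_coef \<alpha> n k * w ^ k) \<longlonglongrightarrow> complex_of_real (bcoef \<alpha> k) * w ^ k" for k
  proof -
    have "(\<lambda>n. of_real (falling_ratio n k * bcoef \<alpha> k) * w ^ k) \<longlonglongrightarrow> complex_of_real (1 * bcoef \<alpha> k) * w ^ k"
      by (intro tendsto_intros falling_ratio_LIMSEQ)
    then show ?thesis by (simp add: bapprox_coef_def)
  qed
  show "\<forall>\<^sub>F (k, n) in sequentially \<times>\<^sub>F sequentially. norm (bapprox_coef \<alpha> n k * w ^ k) \<le> \<bar>bcoef \<alpha> k\<bar> * norm w ^ k"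
    by (intro always_eventually) (auto simp: norm_mult norm_power intro!: mult_right_mono norm_bapprox_coef_le)
qed (auto intro: summable_abs_bcoef[OF assms])

text \<open>Tannery's theorem again; \<open>bcoef_Suc\<close> turns the dominating series into the
  one of parameter \<open>\<alpha> + 1\<close>.\<close>

lemma bapprox'_LIMSEQ:
  assumes "\<alpha> > 0"
  shows "(\<lambda>n. bapprox' \<alpha> n w) \<longlonglongrightarrow> - bfun (\<alpha> + 1) w / (4 * of_real \<alpha>)"
proof -
  have b: "real (Suc k) * \<bar>bcoef \<alpha> (Suc k)\<bar> = \<bar>bcoef (\<alpha> + 1) k\<bar> / (4 * \<alpha>)" for k
    using arg_cong[OF bcoef_Suc[OF assms, of k], of abs] assms by (simp add: abs_mult)
  have "(\<lambda>n. bapprox' \<alpha> n w) \<longlonglongrightarrow> (\<Sum>k. of_real (- bcoef (\<alpha> + 1) k / (4 * \<alpha>)) * w ^ k)"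
    unfolding bapprox'_def
  proof (rule conjunct2[OF conjunct2[OF tannerys_theorem]])
    show "(\<lambda>n. diffs (bapprox_coef \<alpha> n) k * w ^ k) \<longlonglongrightarrow> complex_of_real (- bcoef (\<alpha> + 1) k / (4 * \<alpha>)) * w ^ k" for k
    proof -
      have "(\<lambda>n. of_real (real (Suc k) * (falling_ratio n (Suc k) * bcoef \<alpha> (Suc k))) * w ^ k)
          \<longlonglongrightarrow> complex_of_real (real (Suc k) * (1 * bcoef \<alpha> (Suc k))) * w ^ k"
        by (intro tendsto_intros falling_ratio_LIMSEQ)
      moreover have "(\<lambda>n. diffs (bapprox_coef \<alpha> n) k * w ^ k)
          = (\<lambda>n. of_real (real (Suc k) * (falling_ratio n (Suc k) * bcoef \<alpha> (Suc k))) * w ^ k)"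
        by (simp add: diffs_def bapprox_coef_def)
      ultimately show ?thesis by (simp only: mult_1 bcoef_Suc[OF assms])
    qed
    show "\<forall>\<^sub>F (k, n) in sequentially \<times>\<^sub>F sequentially. norm (diffs (bapprox_coef \<alpha> n) k * w ^ k)
        \<le> \<bar>bcoef (\<alpha> + 1) k\<bar> / (4 * \<alpha>) * norm w ^ k"
      unfolding b[symmetric] diffs_def norm_mult norm_power norm_of_nat
      by (intro always_eventually) (auto intro!: mult_right_mono mult_left_mono norm_bapprox_coef_le simp del: of_nat_Suc)
    show "summable (\<lambda>k. \<bar>bcoef (\<alpha> + 1) k\<bar> / (4 * \<alpha>) * norm w ^ k)"
      using summable_divide[OF summable_abs_bcoef[of "\<alpha> + 1" "norm w"], of "4 * \<alpha>"] assms by simp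
  qed auto
  also have "(\<Sum>k. of_real (- bcoef (\<alpha> + 1) k / (4 * \<alpha>)) * w ^ k) = - (1 / (4 * of_real \<alpha>)) * bfun (\<alpha> + 1) w"
  proof -
    have "(\<lambda>k. of_real (- bcoef (\<alpha> + 1) k / (4 * \<alpha>)) * w ^ k) = (\<lambda>k. - (1 / (4 * of_real \<alpha>)) * (of_real (bcoef (\<alpha> + 1) k) * w ^ k))"
      by auto
    then show ?thesis unfolding bfun_def using assms
      by (simp only: suminf_mult[OF summable_bfun])
  qed
  finally show ?thesis by simp
qed

text \<open>The scaling \<open>w / (4 n)\<close> supplies \<open>(1/4)^j / n^j\<close>, and the
  division makes the value at 0 equal to 1: \<open>pochhammer \<alpha> n\<close> splits at j, and
  its upper part cancels against the Laguerre coefficient.\<close>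

lemma bapprox_eq_laguerre:
  assumes "\<alpha> > 0" "n > 0"
  shows "bapprox \<alpha> n w = poly (laguerre n \<alpha>) (w / of_nat (4 * n)) / of_real (pochhammer \<alpha> n)"
proof -
  have pn: "pochhammer \<alpha> k \<noteq> 0" for k using pochhammer_pos[OF assms(1), of k] by simp
  have deg: "degree (laguerre n \<alpha>) \<le> n" by (rule degree_le) (simp add: coeff_laguerre)
  have "poly (laguerre n \<alpha>) (w / of_nat (4 * n)) / of_real (pochhammer \<alpha> n)
      = (\<Sum>j\<le>n. coeff (laguerre n \<alpha>) j * (w / of_nat (4 * n)) ^ j / of_real (pochhammer \<alpha> n))"
    unfolding poly_altdef sum_divide_distrib
    by (rule sum.mono_neutral_left) (use deg in \<open>auto simp: coeff_eq_0\<close>)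
  also have "\<dots> = (\<Sum>j\<le>n. bapprox_coef \<alpha> n j * w ^ j)"
  proof (intro sum.cong refl)
    fix j assume j: "j \<in> {..n}"
    have p: "pochhammer \<alpha> n = pochhammer \<alpha> j * pochhammer (\<alpha> + real j) (n - j)"
      using j by (intro pochhammer_product) auto
    have "(-1) ^ j * real (n choose j) * pochhammer (\<alpha> + of_nat j) (n - j) / real (4 * n) ^ j / pochhammer \<alpha> n
        = falling_ratio n j * bcoef \<alpha> j"
      using pn[of n] pn[of j] assms(2) unfolding p
      by (simp add: falling_ratio_def bcoef_def power_minus[of "1/4"] power_divide power_mult_distrib mult_ac)
    then have "complex_of_real ((-1) ^ j * real (n choose j) * pochhammer (\<alpha> + of_nat j) (n - j) / real (4 * n) ^ j / pochhammer \<alpha> n)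
        = bapprox_coef \<alpha> n j" by (simp only: bapprox_coef_def)
    from arg_cong[OF this, of "\<lambda>x. x * w ^ j"]
    show "coeff (laguerre n \<alpha>) j * (w / of_nat (4 * n)) ^ j / of_real (pochhammer \<alpha> n) = bapprox_coef \<alpha> n j * w ^ j"
      by (simp add: coeff_laguerre power_divide)
  qed
  also have "\<dots> = (\<Sum>j. bapprox_coef \<alpha> n j * w ^ j)"
    by (rule suminf_finite[symmetric]) (auto simp: bapprox_coef_def falling_ratio_def)
  finally show ?thesis by (simp add: bapprox_def)
qed

section \<open>Bounds on the logarithmic derivative, uniform in the degree\<close>

definition bapprox_roots :: "real \<Rightarrow> nat \<Rightarrow> nat \<Rightarrow> (nat \<Rightarrow> real) \<Rightarrow> bool" where
  "bapprox_roots \<alpha> n m r \<longleftrightarrow> (\<forall>i<m. r i > 0) \<and> (\<Sum>i<m. 1 / r i) = 1 / (4 * \<alpha>) \<and>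
     (\<forall>w. (\<forall>i<m. w \<noteq> of_real (r i)) \<longrightarrow>
        bapprox' \<alpha> n w = bapprox \<alpha> n w * (\<Sum>i<m. 1 / (w - of_real (r i))))"

text \<open>The roots are those of the Laguerre polynomial times \<open>4 n\<close>. That their
  reciprocal sum is independent of n lets the later bounds survive the limit.\<close>

lemma ex_bapprox_roots:
  assumes "\<alpha> > 0" "n > 0"
  shows "\<exists>m r. bapprox_roots \<alpha> n m r"
proof -
  define p where "p = laguerre n \<alpha>"
  define c :: complex where "c = of_nat (4 * n)"
  have c: "c \<noteq> 0" using assms by (simp add: c_def)
  obtain r where r: "\<And>i. i < degree p \<Longrightarrow> r i > (0::real)"
      "\<And>w. poly p w = lead_coeff p * (\<Prod>i<degree p. (w - of_real (r i)))"
    using complex_poly_decompose_of_real[of p] laguerre_roots_positive[OF assms(1), of n] unfolding p_def by blast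
  define s where "s i = real (4 * n) * r i" for i
  define C where "C = lead_coeff p / of_real (pochhammer \<alpha> n) / c ^ degree p"
  have s: "of_real (s i) = c * of_real (r i)" for i by (simp add: s_def c_def)
  have e: "bapprox \<alpha> n w = C * (\<Prod>i<degree p. (w - of_real (s i)))" for w
  proof -
    have "(\<Prod>i<degree p. (w - of_real (s i))) = (\<Prod>i<degree p. c * (w / c - of_real (r i)))"
      using c by (intro prod.cong) (auto simp: s field_simps)
    also have "\<dots> = c ^ degree p * (\<Prod>i<degree p. (w / c - of_real (r i)))"
      by (simp add: prod.distrib)
    finally show ?thesis using c
      unfolding bapprox_eq_laguerre[OF assms] p_def[symmetric] c_def[symmetric] r(2)[of "w / c"] C_def by simp
  qed
  have d: "bapprox' \<alpha> n w = bapprox \<alpha> n w * (\<Sum>i<degree p. 1 / (w - of_real (s i)))"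
    if w: "\<forall>i<degree p. w \<noteq> of_real (s i)" for w
  proof -
    have "((\<lambda>w. C * (\<Prod>i<degree p. (w - of_real (s i)))) has_field_derivative
        C * ((\<Prod>i<degree p. (w - of_real (s i))) * (\<Sum>i<degree p. 1 / (w - of_real (s i))))) (at w)"
      by (intro DERIV_cmult has_field_derivative_prod_linear) (use w in auto)
    then have "(bapprox \<alpha> n has_field_derivative bapprox \<alpha> n w * (\<Sum>i<degree p. 1 / (w - of_real (s i)))) (at w)"
      unfolding mult.assoc[symmetric] e[symmetric] .
    with DERIV_bapprox[OF assms(1)] show ?thesis by (rule DERIV_unique)
  qed
  have spos: "s i > 0" if "i < degree p" for i using r(1)[OF that] assms(2) by (simp add: s_def)
  \<comment> \<open>At 0 the logarithmic derivative is minus the reciprocal sum; the first two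
    coefficients give its value, as \<open>falling_ratio n 1 = 1\<close> for n > 0.\<close>
  have "bapprox \<alpha> n 0 = 1" "bapprox' \<alpha> n 0 = of_real (- 1 / (4 * \<alpha>))"
    unfolding bapprox_def bapprox'_def powser_zero
    using assms by (simp_all add: bapprox_coef_def diffs_def falling_ratio_def bcoef_def)
  then have "of_real (- 1 / (4 * \<alpha>)) = (\<Sum>i<degree p. 1 / (0 - complex_of_real (s i)))"
    using d[of 0] spos by force
  also have "\<dots> = complex_of_real (- (\<Sum>i<degree p. 1 / s i))" by (simp add: sum_negf)
  finally have "- 1 / (4 * \<alpha>) = - (\<Sum>i<degree p. 1 / s i)" by (simp only: of_real_eq_iff)
  then have "bapprox_roots \<alpha> n (degree p) s"
    unfolding bapprox_roots_def using d spos by auto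
  then show ?thesis by blast
qed

text \<open>Each term \<open>1 / (w - r)\<close> of the logarithmic derivative has norm at most
  \<open>C / r\<close>, and the reciprocals add up to \<open>1 / (4 * \<alpha>)\<close>.\<close>

lemma norm_bapprox'_le:
  assumes "bapprox_roots \<alpha> n m r" "\<And>i. i < m \<Longrightarrow> r i \<le> C * norm (w - of_real (r i))"
  shows "norm (bapprox' \<alpha> n w) \<le> C / (4 * \<alpha>) * norm (bapprox \<alpha> n w)"
proof -
  have pos: "r i > 0" if "i < m" for i using assms(1) that by (auto simp: bapprox_roots_def)
  have ne: "w \<noteq> of_real (r i)" if "i < m" for i using pos[OF that] assms(2)[OF that] by auto
  have "norm (\<Sum>i<m. 1 / (w - of_real (r i))) \<le> (\<Sum>i<m. C * (1 / r i))"
  proof (intro sum_norm_le)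
    fix i assume i: "i \<in> {..<m}"
    then have "norm (w - of_real (r i)) > 0" using ne by auto
    then show "norm (1 / (w - of_real (r i))) \<le> C * (1 / r i)"
      using i pos[of i] assms(2)[of i] by (simp add: norm_divide field_simps)
  qed
  also have "\<dots> = C * (1 / (4 * \<alpha>))"
    unfolding sum_distrib_left[symmetric] using assms(1) by (simp only: bapprox_roots_def)
  finally have "norm (\<Sum>i<m. 1 / (w - of_real (r i))) \<le> C / (4 * \<alpha>)" by simp
  then have "norm (bapprox \<alpha> n w) * norm (\<Sum>i<m. 1 / (w - of_real (r i))) \<le> norm (bapprox \<alpha> n w) * (C / (4 * \<alpha>))"
    by (intro mult_left_mono) auto
  moreover have "bapprox' \<alpha> n w = bapprox \<alpha> n w * (\<Sum>i<m. 1 / (w - of_real (r i)))"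
    using assms(1) ne by (auto simp: bapprox_roots_def)
  ultimately show ?thesis by (simp add: norm_mult mult_ac)
qed

text \<open>The limit of \<open>norm_bapprox'_le\<close> for large n. Nothing is divided by
  \<open>bfun \<alpha> w\<close>, so the bound also speaks at zeros.\<close>

lemma norm_bfun_Suc_le:
  assumes "\<alpha> > 0" "\<And>r. r > 0 \<Longrightarrow> r \<le> C * norm (w - of_real r)"
  shows "norm (bfun (\<alpha> + 1) w) \<le> C * norm (bfun \<alpha> w)"
proof -
  have "norm (- bfun (\<alpha> + 1) w / (4 * of_real \<alpha>)) \<le> C / (4 * \<alpha>) * norm (bfun \<alpha> w)"
  proof (rule tendsto_le[OF sequentially_bot])
    show "(\<lambda>n. C / (4 * \<alpha>) * norm (bapprox \<alpha> n w)) \<longlonglongrightarrow> C / (4 * \<alpha>) * norm (bfun \<alpha> w)"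
      by (intro tendsto_intros bapprox_LIMSEQ assms)
    show "(\<lambda>n. norm (bapprox' \<alpha> n w)) \<longlonglongrightarrow> norm (- bfun (\<alpha> + 1) w / (4 * of_real \<alpha>))"
      by (intro tendsto_norm bapprox'_LIMSEQ assms)
    show "\<forall>\<^sub>F n in sequentially. norm (bapprox' \<alpha> n w) \<le> C / (4 * \<alpha>) * norm (bapprox \<alpha> n w)"
      using eventually_gt_at_top[of 0]
    proof eventually_elim
      case (elim n)
      obtain m r where "bapprox_roots \<alpha> n m r" using ex_bapprox_roots[OF assms(1) elim] by blast
      then show ?case
        by (rule norm_bapprox'_le) (use \<open>bapprox_roots \<alpha> n m r\<close> assms(2) in \<open>auto simp: bapprox_roots_def\<close>)
    qed
  qed
  then show ?thesis using assms(1) by (simp add: norm_divide norm_mult field_simps)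
qed

text \<open>In the triangle 0, r, w the left side is twice the area and the right side the product
  of two sides; formally, \<open>w * cnj (w - r)\<close> has imaginary part
  \<open>- r * Im w\<close>.\<close>

lemma mult_abs_Im_le:
  assumes "r > 0"
  shows "r * \<bar>Im w\<bar> \<le> norm w * norm (w - of_real r)"
proof -
  have "r * \<bar>Im w\<bar> = \<bar>Im (w * cnj (w - of_real r))\<bar>"
    using assms by (simp add: algebra_simps abs_mult)
  also have "\<dots> \<le> norm (w * cnj (w - of_real r))" by (rule abs_Im_le_cmod)
  also have "\<dots> = norm w * norm (w - of_real r)" by (simp only: norm_mult complex_mod_cnj)
  finally show ?thesis .
qed

lemma norm_bfun_Suc_le_Im:
  assumes "\<alpha> > 0" "Im w \<noteq> 0"
  shows "norm (bfun (\<alpha> + 1) w) \<le> norm w / \<bar>Im w\<bar> * norm (bfun \<alpha> w)"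
  using assms mult_abs_Im_le[of _ w] by (intro norm_bfun_Suc_le) (auto simp: field_simps)

lemma norm_bfun_Suc_le_Re:
  assumes "\<alpha> > 0" "Re w \<le> 0"
  shows "norm (bfun (\<alpha> + 1) w) \<le> norm (bfun \<alpha> w)"
proof -
  have "r \<le> 1 * norm (w - of_real r)" if "r > 0" for r
    using abs_Re_le_cmod[of "w - of_real r"] assms(2) that by simp
  from norm_bfun_Suc_le[OF assms(1), of 1 w, OF this] show ?thesis by simp
qed

section \<open>Simplicity and positivity of the zeros, summability of their reciprocals\<close>

lemma higher_deriv_bfun:
  assumes "\<alpha> > 0"
  shows "\<exists>c. (deriv ^^ n) (bfun \<alpha>) = (\<lambda>w. c * bfun (\<alpha> + real n) w)"
proof (induction n)
  case 0
  show ?case by (rule exI[of _ 1]) auto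
next
  case (Suc n)
  then obtain c where c: "(deriv ^^ n) (bfun \<alpha>) = (\<lambda>w. c * bfun (\<alpha> + real n) w)" by blast
  have "deriv (\<lambda>w. c * bfun (\<alpha> + real n) w) w = c * (- bfun (\<alpha> + real n + 1) w / (4 * of_real (\<alpha> + real n)))" for w
    using assms by (intro DERIV_imp_deriv DERIV_cmult DERIV_bfun) auto
  then have "(deriv ^^ Suc n) (bfun \<alpha>) = (\<lambda>w. - c / (4 * of_real (\<alpha> + real n)) * bfun (\<alpha> + real (Suc n)) w)"
    using c by (auto simp: add_ac)
  then show ?case by blast
qed

text \<open>This is simplicity of the zeros. The contiguous relation would spread a common zero,
  which is not 0, to all parameters \<open>\<alpha> + n\<close>; all derivatives would vanish there,
  and \<open>bfun \<alpha>\<close> would be identically 0, against its value 1 at 0.\<close>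

lemma bfun_no_common_zero:
  assumes "\<alpha> > 0" "bfun \<alpha> w = 0"
  shows "bfun (\<alpha> + 1) w \<noteq> 0"
proof
  assume a1: "bfun (\<alpha> + 1) w = 0"
  have w: "w \<noteq> 0" using assms(2) by auto
  have z: "bfun (\<alpha> + real n) w = 0 \<and> bfun (\<alpha> + real n + 1) w = 0" for n
  proof (induction n)
    case (Suc n)
    have pos: "\<alpha> + real n > 0" using assms by simp
    have "complex_of_real (\<alpha> + real n) \<noteq> 0" "complex_of_real (\<alpha> + real n + 1) \<noteq> 0"
      using pos unfolding of_real_eq_0_iff by simp_all
    then have nz: "complex_of_real (\<alpha> + real n) \<noteq> 0" "complex_of_real (\<alpha> + real n) + 1 \<noteq> 0"
      by (simp_all only: of_real_add[of _ 1] of_real_1 not_False_eq_True)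
    have "w * bfun (\<alpha> + real n + 2) w = 0"
      using bfun_contiguous[OF pos, of w] Suc nz by (simp del: of_real_add)
    then show ?case using w Suc by (simp add: add_ac)
  qed (use assms a1 in auto)
  have "(deriv ^^ n) (bfun \<alpha>) w = 0" for n
    using higher_deriv_bfun[OF assms(1), of n] z[of n] by auto
  then have "bfun \<alpha> 0 = 0"
    by (intro holomorphic_fun_eq_0_on_connected[OF holomorphic_bfun[OF assms(1)], of UNIV w]) auto
  then show False by simp
qed

text \<open>At a zero off the real axis or with \<open>Re w \<le> 0\<close>, one of the two
  preceding bounds would force \<open>bfun (\<alpha> + 1) w = 0\<close>, a common zero.\<close>

lemma bfun_zero_positive:
  assumes "\<alpha> > 0" "bfun \<alpha> w = 0"
  shows "w \<in> of_real ` {0<..}"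
proof -
  have "Im w = 0" using norm_bfun_Suc_le_Im[OF assms(1), of w] bfun_no_common_zero[OF assms] assms(2) by auto
  moreover have "Re w > 0"
    using norm_bfun_Suc_le_Re[OF assms(1), of w] bfun_no_common_zero[OF assms] assms(2) by force
  ultimately show ?thesis by (intro image_eqI[of _ _ "Re w"]) (auto simp: complex_eq_iff)
qed

text \<open>A set of reals loses nothing: all complex zeros are positive by
  \<open>bfun_zero_positive\<close> and simple by \<open>bfun_no_common_zero\<close>.\<close>

definition bzeros :: "real \<Rightarrow> real set" where
  "bzeros \<alpha> = {x. x > 0 \<and> bfun \<alpha> (of_real x) = 0}"

text \<open>Roots staying away from \<open>a\<close> would keep the logarithmic derivative of the approximants bounded
  at \<open>a\<close>, so in the limit \<open>a\<close> would be a multiple zero.\<close>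

lemma eventually_bapprox_root_near:
  assumes "\<alpha> > 0" "a \<in> bzeros \<alpha>" "\<epsilon> > 0"
  shows "\<forall>\<^sub>F n in sequentially. \<forall>m r. bapprox_roots \<alpha> n m r \<longrightarrow> (\<exists>i<m. \<bar>a - r i\<bar> < \<epsilon>)"
proof -
  \<comment> \<open>If \<open>\<bar>a - r\<bar> \<ge> \<epsilon>\<close>, then \<open>r \<le> a +
    \<bar>a - r\<bar> \<le> (a / \<epsilon> + 1) * \<bar>a - r\<bar>\<close>.\<close>
  define C where "C = a / \<epsilon> + 1"
  have a: "a > 0" "bfun \<alpha> (of_real a) = 0" using assms by (auto simp: bzeros_def)
  have "(\<lambda>n. norm (bapprox' \<alpha> n a) - C / (4 * \<alpha>) * norm (bapprox \<alpha> n a)) \<longlonglongrightarrow>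
     norm (- bfun (\<alpha> + 1) a / (4 * of_real \<alpha>)) - C / (4 * \<alpha>) * norm (bfun \<alpha> a)"
    by (intro tendsto_intros bapprox'_LIMSEQ bapprox_LIMSEQ assms)
  moreover have "norm (- bfun (\<alpha> + 1) a / (4 * of_real \<alpha>)) - C / (4 * \<alpha>) * norm (bfun \<alpha> a) > 0"
    using a(2) bfun_no_common_zero[OF assms(1) a(2)] assms(1) by simp
  ultimately have "\<forall>\<^sub>F n in sequentially. norm (bapprox' \<alpha> n a) - C / (4 * \<alpha>) * norm (bapprox \<alpha> n a) > 0"
    by (rule order_tendstoD)
  then show ?thesis
  proof (eventually_elim, intro allI impI)
    fix n m r
    assume lt: "norm (bapprox' \<alpha> n a) - C / (4 * \<alpha>) * norm (bapprox \<alpha> n a) > 0"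
      and r: "bapprox_roots \<alpha> n m r"
    show "\<exists>i<m. \<bar>a - r i\<bar> < \<epsilon>"
    proof (rule ccontr)
      assume "\<not> ?thesis"
      then have ge: "\<bar>a - r i\<bar> \<ge> \<epsilon>" if "i < m" for i using that by force
      have "r i \<le> C * norm (complex_of_real a - of_real (r i))" if "i < m" for i
      proof -
        have "a = a / \<epsilon> * \<epsilon>" using assms by simp
        also have "\<dots> \<le> a / \<epsilon> * \<bar>a - r i\<bar>" using a assms(3) ge[OF that] by (intro mult_left_mono) auto
        finally have "r i \<le> C * \<bar>a - r i\<bar>" by (simp add: C_def distrib_right)
        then show ?thesis by (simp flip: of_real_diff)
      qed
      from norm_bapprox'_le[OF r this] lt show False by simp
    qed
  qed
qed

text \<open>For large n each zero a in A has its own approximating root r with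
  \<open>r \<le> 2 * a\<close>, so the sum is at most twice the reciprocal sum
  \<open>1 / (4 * \<alpha>)\<close> of all roots.\<close>

lemma sum_inverse_bzeros_le:
  assumes "\<alpha> > 0" "finite A" "A \<subseteq> bzeros \<alpha>"
  shows "(\<Sum>a\<in>A. 1 / a) \<le> 1 / (2 * \<alpha>)"
proof -
  \<comment> \<open>The 1 keeps D nonempty; the members of A give \<open>\<epsilon> \<le> a\<close>,
    hence \<open>r \<le> 2 * a\<close>; the half distances prevent two zeros from sharing a
    root.\<close>
  define D where "D = insert 1 (A \<union> (\<lambda>(a, b). \<bar>a - b\<bar> / 2) ` {(a, b) \<in> A \<times> A. a \<noteq> b})"
  define \<epsilon> where "\<epsilon> = Min D"
  have Dfin: "finite D" unfolding D_def using assms(2)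
    by (auto intro!: finite_imageI intro: finite_subset[of _ "A \<times> A"])
  have Dpos: "\<forall>x\<in>D. x > 0" using assms(3) by (auto simp: D_def bzeros_def)
  have eps: "\<epsilon> > 0" unfolding \<epsilon>_def using Dfin Dpos by (subst Min_gr_iff) (auto simp: D_def)
  have le1: "\<epsilon> \<le> a" if "a \<in> A" for a
    unfolding \<epsilon>_def using Dfin that by (intro Min_le) (auto simp: D_def)
  have le2: "\<epsilon> \<le> \<bar>a - b\<bar> / 2" if "a \<in> A" "b \<in> A" "a \<noteq> b" for a b
    unfolding \<epsilon>_def using Dfin that by (intro Min_le) (auto simp: D_def)
  have "\<forall>\<^sub>F n in sequentially. \<forall>a\<in>A. \<forall>m r. bapprox_roots \<alpha> n m r \<longrightarrow> (\<exists>i<m. \<bar>a - r i\<bar> < \<epsilon>)"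
    using assms eps by (intro eventually_ball_finite ballI eventually_bapprox_root_near) auto
  then have "\<forall>\<^sub>F n in sequentially. n > 0 \<and> (\<forall>a\<in>A. \<forall>m r. bapprox_roots \<alpha> n m r \<longrightarrow> (\<exists>i<m. \<bar>a - r i\<bar> < \<epsilon>))"
    using eventually_gt_at_top[of 0] by eventually_elim auto
  then obtain n where n: "n > 0" "\<And>a m r. a \<in> A \<Longrightarrow> bapprox_roots \<alpha> n m r \<Longrightarrow> \<exists>i<m. \<bar>a - r i\<bar> < \<epsilon>"
    by (auto dest!: eventually_happens)
  obtain m r where r: "bapprox_roots \<alpha> n m r" using ex_bapprox_roots[OF assms(1) n(1)] by blast
  obtain f where f: "\<And>a. a \<in> A \<Longrightarrow> f a < m \<and> \<bar>a - r (f a)\<bar> < \<epsilon>"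
    using n(2)[OF _ r] by metis
  have rpos: "r i > 0" if "i < m" for i using r that by (auto simp: bapprox_roots_def)
  have inj: "inj_on f A"
  proof (rule inj_onI, rule ccontr)
    fix a b assume *: "a \<in> A" "b \<in> A" "f a = f b" "a \<noteq> b"
    then have "\<bar>a - r (f a)\<bar> < \<epsilon>" "\<bar>b - r (f a)\<bar> < \<epsilon>" using f[of a] f[of b] by auto
    then show False using le2[OF *(1,2,4)] abs_triangle_ineq4[of "a - r (f a)" "b - r (f a)"] by simp
  qed
  have "(\<Sum>a\<in>A. 1 / a) \<le> (\<Sum>a\<in>A. 2 * (1 / r (f a)))"
  proof (intro sum_mono)
    fix a assume a: "a \<in> A"
    have "r (f a) \<le> 2 * a" "r (f a) > 0" "a > 0"
      using f[OF a] le1[OF a] rpos a assms(3) by (auto simp: bzeros_def)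
    then show "1 / a \<le> 2 * (1 / r (f a))" by (simp add: field_simps)
  qed
  also have "\<dots> = 2 * (\<Sum>i\<in>f ` A. 1 / r i)"
    by (simp add: sum.reindex[OF inj] sum_distrib_left)
  also have "(\<Sum>i\<in>f ` A. 1 / r i) \<le> (\<Sum>i<m. 1 / r i)"
  proof (rule sum_mono2)
    show "f ` A \<subseteq> {..<m}" using f by blast
    show "1 / r i \<ge> 0" if "i \<in> {..<m} - f ` A" for i using rpos[of i] that by simp
  qed simp
  also have "\<dots> = 1 / (4 * \<alpha>)" using r by (simp add: bapprox_roots_def)
  finally show ?thesis by simp
qed

lemma summable_inverse_bzeros:
  assumes "\<alpha> > 0"
  shows "(\<lambda>a. 1 / a) summable_on bzeros \<alpha>"
proof (rule nonneg_bdd_above_summable_on)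
  show "bdd_above (sum (\<lambda>a. 1 / a) ` {F. F \<subseteq> bzeros \<alpha> \<and> finite F})"
    using sum_inverse_bzeros_le[OF assms] by (auto intro!: bdd_aboveI[of _ "1 / (2 * \<alpha>)"])
qed (auto simp: bzeros_def)

text \<open>Each zero up to R contributes at least \<open>1 / R\<close> to a reciprocal sum bounded
  by \<open>1 / (2 * \<alpha>)\<close>.\<close>

lemma finite_bzeros_atMost:
  assumes "\<alpha> > 0"
  shows "finite (bzeros \<alpha> \<inter> {..R})"
proof (rule conjunct1[OF finite_if_finite_subsets_card_bdd[of _ "nat \<lceil>R / (2 * \<alpha>)\<rceil>"]])
  fix A assume A: "A \<subseteq> bzeros \<alpha> \<inter> {..R}" "finite A"
  show "card A \<le> nat \<lceil>R / (2 * \<alpha>)\<rceil>"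
  proof (cases "A = {}")
    case False
    then have R: "R > 0" using A by (force simp: bzeros_def)
    have "real (card A) * (1 / R) \<le> (\<Sum>a\<in>A. 1 / a)"
      using A R by (intro sum_bounded_below) (force simp: bzeros_def field_simps)
    also have "\<dots> \<le> 1 / (2 * \<alpha>)" using A by (intro sum_inverse_bzeros_le assms) auto
    finally have "real (card A) \<le> R / (2 * \<alpha>)" using R assms by (simp add: field_simps)
    then show ?thesis by linarith
  qed simp
qed

subsection \<open>The logarithmic derivative\<close>

text \<open>Zeros are divided out one at a time: K vanishes at the new point because the earlier
  factors do not, and the difference quotient has a removable singularity there.\<close>

lemma entire_factor_zeros:
  fixes A :: "complex set"
  assumes "finite A" "f holomorphic_on UNIV" "\<And>a. a \<in> A \<Longrightarrow> f a = 0"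
  shows "\<exists>K. K holomorphic_on UNIV \<and> (\<forall>z. f z = (\<Prod>a\<in>A. (z - a)) * K z)"
  using assms
proof (induction A rule: finite_induct)
  case empty
  then show ?case by auto
next
  case (insert x A)
  then obtain K where K: "K holomorphic_on UNIV" "\<And>z. f z = (\<Prod>a\<in>A. (z - a)) * K z" by auto
  have "(\<Prod>a\<in>A. (x - a)) \<noteq> 0" using insert by auto
  moreover have "f x = 0" using insert.prems(2) by simp
  ultimately have Kx: "K x = 0" using K(2)[of x] by simp
  define L where "L z = (if z = x then deriv K x else (K z - K x) / (z - x))" for z
  have "L holomorphic_on UNIV"
    unfolding L_def[abs_def] by (rule pole_lemma[OF K(1)]) simp
  moreover have "K z = (z - x) * L z" for z using Kx by (simp add: L_def)
  ultimately show ?case using insert K(2) by (intro exI[of _ L]) (simp add: mult_ac)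
qed

text \<open>On the circle \<open>\<bar>z\<bar> = R\<close> one has \<open>\<bar>z\<^sup>2 - R\<^sup>2\<bar> = 2 R \<bar>Im z\<bar>\<close>, so multiplying by \<open>z\<^sup>2 - R\<^sup>2\<close> cancels the
  blow-up of the bound at the real axis.\<close>

lemma holomorphic_increment_le:
  fixes u :: "complex \<Rightarrow> complex"
  assumes R: "R > 0" and B: "B \<ge> 0" and U: "open U" "cball 0 R \<subseteq> U" and u: "u holomorphic_on U"
    and bd: "\<And>z. norm z = R \<Longrightarrow> Im z \<noteq> 0 \<Longrightarrow> norm (u z) \<le> B * R / \<bar>Im z\<bar>"
    and w: "norm w \<le> R / 4"
  shows "norm (u w - u 0) \<le> 32 / 3 * B / R * norm w"
proof -
  define g where "g z = u z * (z\<^sup>2 - of_real (R\<^sup>2))" for z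
  have ucb: "u holomorphic_on cball 0 R" using u U(2) by (rule holomorphic_on_subset)
  have g: "g holomorphic_on cball 0 R" unfolding g_def[abs_def] by (intro holomorphic_intros ucb)
  have gB: "norm (g z) \<le> 2 * B * R\<^sup>2" if "norm z \<le> R" for z
  proof (rule maximum_modulus_frontier[of g "cball 0 R"])
    show "g holomorphic_on interior (cball 0 R)"
      using g interior_subset by (rule holomorphic_on_subset)
    show "continuous_on (closure (cball 0 R)) g"
      using holomorphic_on_imp_continuous_on[OF g] by simp
    show "norm (g z) \<le> 2 * B * R\<^sup>2" if "z \<in> frontier (cball 0 R)" for z
    proof -
      have z: "norm z = R" using that by (simp add: sphere_def)
      \<comment> \<open>On the circle \<open>R^2 = z * cnj z\<close>.\<close>
      have "z\<^sup>2 - of_real (R\<^sup>2) = z * (z - cnj z)"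
        using complex_norm_square[of z] z by (simp add: power2_eq_square algebra_simps)
      then have n: "norm (z\<^sup>2 - of_real (R\<^sup>2)) = R * (2 * \<bar>Im z\<bar>)"
        using z by (simp add: norm_mult complex_diff_cnj)
      show ?thesis
      proof (cases "Im z = 0")
        case True
        then show ?thesis using n B by (simp add: g_def norm_mult)
      next
        case False
        have "norm (u z) * (R * (2 * \<bar>Im z\<bar>)) \<le> B * R / \<bar>Im z\<bar> * (R * (2 * \<bar>Im z\<bar>))"
          using R by (intro mult_right_mono bd z False) auto
        then show ?thesis using n False by (simp add: g_def norm_mult power2_eq_square mult_ac)
      qed
    qed
  qed (use that in auto)
  \<comment> \<open>The factor \<open>z^2 - R^2\<close> has modulus at least
    \<open>3/4 * R^2\<close> here, and \<open>2 / (3/4) = 8/3\<close>.\<close>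
  have uB: "norm (u z) \<le> 8 / 3 * B" if z: "norm z \<le> R / 2" for z
  proof -
    have "(norm z)\<^sup>2 \<le> (R / 2)\<^sup>2" using z by (intro power_mono) auto
    then have "3 / 4 * R\<^sup>2 \<le> R\<^sup>2 - (norm z)\<^sup>2" by (simp add: power2_eq_square)
    also have "\<dots> \<le> norm (z\<^sup>2 - of_real (R\<^sup>2))"
      using norm_triangle_ineq2[of "of_real (R\<^sup>2)" "z\<^sup>2"] by (simp add: norm_power norm_minus_commute)
    finally have "norm (u z) * (3 / 4 * R\<^sup>2) \<le> norm (u z) * norm (z\<^sup>2 - of_real (R\<^sup>2))"
      by (intro mult_left_mono) auto
    also have "\<dots> \<le> 2 * B * R\<^sup>2" using gB[of z] z R by (simp add: g_def norm_mult)
    finally show ?thesis using R by (simp add: field_simps)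
  qed
  \<comment> \<open>Cauchy's inequality on a circle of radius \<open>R / 4\<close>, which stays in
    the disc of radius \<open>R / 2\<close>.\<close>
  have dB: "norm (deriv u z) \<le> 32 / 3 * B / R" if z: "norm z \<le> R / 4" for z
  proof -
    have sub: "cball z (R / 4) \<subseteq> cball 0 R" using z R by (subst cball_subset_cball_iff) simp
    have "norm ((deriv ^^ 1) u z) \<le> fact 1 * (8 / 3 * B) / (R / 4) ^ 1"
    proof (rule Cauchy_inequality)
      show "u holomorphic_on ball z (R / 4)"
        using sub ball_subset_cball by (intro holomorphic_on_subset[OF ucb]) blast
      show "continuous_on (cball z (R / 4)) u"
        using sub by (intro holomorphic_on_imp_continuous_on holomorphic_on_subset[OF ucb])
      show "norm (u x) \<le> 8 / 3 * B" if "norm (z - x) = R / 4" for x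
        using z that norm_triangle_ineq4[of z "z - x"] by (intro uB) simp
    qed (use R in auto)
    then show ?thesis by simp
  qed
  have "norm (u w - u 0) \<le> 32 / 3 * B / R * norm (w - 0)"
  proof (rule field_differentiable_bound[of "cball 0 (R / 4)" u "deriv u"])
    show "(u has_field_derivative deriv u z) (at z within cball 0 (R / 4))" if "z \<in> cball 0 (R / 4)" for z
    proof -
      have "z \<in> U" using that U(2) R by auto
      with u U(1) show ?thesis
        by (meson DERIV_subset holomorphic_derivI subset_UNIV)
    qed
  qed (use w dB R in auto)
  then show ?thesis by simp
qed

text \<open>Here u is \<open>K' / K\<close> for the cofactor K left after dividing out the zeros up
  to R. It is holomorphic near the closed disc of radius R, so
  \<open>holomorphic_increment_le\<close> shows that it is nearly constant on bounded sets when R is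
  large.\<close>

lemma log_deriv_remainder:
  assumes \<alpha>: "\<alpha> > 0" and R: "R > 0"
  defines "A \<equiv> bzeros \<alpha> \<inter> {..R}"
  obtains u where
    "\<And>w. bfun \<alpha> w \<noteq> 0 \<Longrightarrow>
       u w = - bfun (\<alpha> + 1) w / (4 * of_real \<alpha> * bfun \<alpha> w) - (\<Sum>a\<in>A. 1 / (w - of_real a))"
    "\<And>b. b \<in> A \<Longrightarrow> u (of_real b) = of_real (- \<alpha> / (2 * b) - (\<Sum>a\<in>A - {b}. 1 / (b - a)))"
    "\<And>w. norm w \<le> R / 4 \<Longrightarrow> norm (u w - u 0) \<le> 8 / \<alpha> / R * norm w"
proof -
  have finA: "finite A" unfolding A_def by (rule finite_bzeros_atMost[OF \<alpha>])
  have A0: "bfun \<alpha> (of_real a) = 0" "a > 0" if "a \<in> A" for a using that by (auto simp: A_def bzeros_def)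
  have "\<exists>K. K holomorphic_on UNIV \<and> (\<forall>z. bfun \<alpha> z = (\<Prod>a\<in>complex_of_real ` A. (z - a)) * K z)"
    using finA A0 by (intro entire_factor_zeros holomorphic_bfun \<alpha>) auto
  then obtain K where K: "K holomorphic_on UNIV" "\<And>z. bfun \<alpha> z = (\<Prod>a\<in>A. (z - of_real a)) * K z"
    by (auto simp: prod.reindex inj_on_def)
  have dK: "(K has_field_derivative deriv K z) (at z)" for z
    using K(1) by (rule holomorphic_derivI) auto
  define u where "u z = deriv K z / K z" for z
  have dF: "(bfun \<alpha> has_field_derivative - bfun (\<alpha> + 1) z / (4 * of_real \<alpha>)) (at z)" for z
    by (rule DERIV_bfun[OF \<alpha>])
  have u1: "u w = - bfun (\<alpha> + 1) w / (4 * of_real \<alpha> * bfun \<alpha> w) - (\<Sum>a\<in>A. 1 / (w - of_real a))"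
    if w: "bfun \<alpha> w \<noteq> 0" for w
  proof -
    define P S where "P = (\<Prod>a\<in>A. (w - of_real a))" and "S = (\<Sum>a\<in>A. 1 / (w - of_real a))"
    have nA: "w \<noteq> of_real a" if "a \<in> A" for a using A0(1)[OF that] w by auto
    have nz: "P \<noteq> 0" "K w \<noteq> 0" using K(2)[of w] w by (auto simp: P_def)
    have "((\<lambda>z. (\<Prod>a\<in>A. (z - of_real a)) * K z) has_field_derivative P * S * K w + deriv K w * P) (at w)"
      unfolding P_def S_def
      by (rule DERIV_mult[OF has_field_derivative_prod_linear[OF finA nA] dK])
    then have "(bfun \<alpha> has_field_derivative P * S * K w + deriv K w * P) (at w)"
      unfolding K(2)[symmetric] .
    with dF have e: "- bfun (\<alpha> + 1) w / (4 * of_real \<alpha>) = P * S * K w + deriv K w * P" by (rule DERIV_unique)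
    have "- bfun (\<alpha> + 1) w / (4 * of_real \<alpha> * bfun \<alpha> w) = - bfun (\<alpha> + 1) w / (4 * of_real \<alpha>) / bfun \<alpha> w"
      by simp
    also have "\<dots> = S + u w" using nz unfolding e by (simp add: K(2) u_def field_simps flip: P_def)
    finally show ?thesis by (simp add: S_def)
  qed
  have u2: "K (of_real b) \<noteq> 0 \<and> u (of_real b) = of_real (- \<alpha> / (2 * b) - (\<Sum>a\<in>A - {b}. 1 / (b - a)))"
    if b: "b \<in> A" for b
  proof -
    define c where "c = complex_of_real b"
    define P S where "P = (\<Prod>a\<in>A - {b}. (c - of_real a))" and "S = (\<Sum>a\<in>A - {b}. 1 / (c - of_real a))"
    \<comment> \<open>M is the cofactor of the single zero c, so \<open>F'(c) = M(c)\<close> and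
      \<open>F''(c) = 2 M'(c)\<close>; \<open>M' / M\<close> at c is the regular part of
      \<open>F' / F\<close>.\<close>
    define M where "M z = (\<Prod>a\<in>A - {b}. (z - of_real a)) * K z" for z
    have c: "c \<noteq> 0" "bfun \<alpha> c = 0" using A0[OF b] by (auto simp: c_def)
    have M: "bfun \<alpha> z = (z - c) * M z" for z
      using b finA by (simp add: K(2) M_def prod.remove[of A b] c_def mult.assoc)
    have holM: "M holomorphic_on UNIV"
      unfolding M_def[abs_def] by (intro holomorphic_intros K)
    have dM: "(M has_field_derivative deriv M z) (at z)" for z
      using holM by (rule holomorphic_derivI) auto
    have "((\<lambda>z. (z - c) * M z) has_field_derivative M z + (z - c) * deriv M z) (at z)" for z
      by (auto intro!: derivative_eq_intros dM)
    then have "(bfun \<alpha> has_field_derivative M z + (z - c) * deriv M z) (at z)" for z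
      unfolding M[symmetric] .
    from DERIV_unique[OF dF this]
    have d1: "- bfun (\<alpha> + 1) z / (4 * of_real \<alpha>) = M z + (z - c) * deriv M z" for z .
    have "(deriv M has_field_derivative deriv (deriv M) c) (at c)"
      using holomorphic_deriv[OF holM] by (rule holomorphic_derivI) auto
    then have "((\<lambda>z. M z + (z - c) * deriv M z) has_field_derivative 2 * deriv M c) (at c)"
      by (auto intro!: derivative_eq_intros dM)
    then have "((\<lambda>z. - bfun (\<alpha> + 1) z / (4 * of_real \<alpha>)) has_field_derivative 2 * deriv M c) (at c)"
      unfolding d1 .
    moreover have "((\<lambda>z. - bfun (\<alpha> + 1) z / (4 * of_real \<alpha>)) has_field_derivative
        - (- bfun (\<alpha> + 2) c / (4 * of_real (\<alpha> + 1))) / (4 * of_real \<alpha>)) (at c)"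
      using DERIV_bfun[of "\<alpha> + 1" c] \<alpha> by (intro DERIV_cdivide DERIV_minus) (simp add: add.assoc)
    ultimately have d2: "2 * deriv M c = bfun (\<alpha> + 2) c / (16 * of_real \<alpha> * (of_real \<alpha> + 1))"
      by (auto dest: DERIV_unique)
    have Mc: "M c = - bfun (\<alpha> + 1) c / (4 * of_real \<alpha>)" using d1[of c] by simp
    then have Mc0: "M c \<noteq> 0" using bfun_no_common_zero[OF \<alpha> c(2)] \<alpha> by simp
    \<comment> \<open>Since \<open>bfun \<alpha> c = 0\<close>, the contiguous relation expresses
      \<open>bfun (\<alpha> + 1) c\<close> by \<open>bfun (\<alpha> + 2) c\<close>, that is,
      \<open>M c\<close> by \<open>deriv M c\<close>.\<close>
    have "M c = - c * (bfun (\<alpha> + 2) c / (16 * of_real \<alpha> * (of_real \<alpha> + 1))) / of_real \<alpha>"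
      unfolding Mc using bfun_contiguous[OF \<alpha>, of c] c(2) by simp
    then have "M c = - c * (2 * deriv M c) / of_real \<alpha>" by (simp only: d2)
    then have q: "deriv M c / M c = - of_real \<alpha> / (2 * c)" using Mc0 c(1) \<alpha> by (simp add: field_simps)
    have nz: "P \<noteq> 0" "K c \<noteq> 0" using Mc0 by (auto simp: M_def P_def)
    have "(M has_field_derivative P * S * K c + deriv K c * P) (at c)"
      unfolding P_def S_def M_def[abs_def]
      by (rule DERIV_mult[OF has_field_derivative_prod_linear dK]) (use finA in \<open>auto simp: c_def\<close>)
    with dM have "deriv M c = P * S * K c + deriv K c * P" by (rule DERIV_unique)
    moreover have "M c = P * K c" by (simp add: M_def P_def)
    ultimately have "deriv M c / M c = S + u c" using nz by (simp add: u_def field_simps)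
    then have "u c = - of_real \<alpha> / (2 * c) - S" unfolding q by (simp add: algebra_simps)
    then show ?thesis using nz by (simp add: c_def S_def)
  qed
  \<comment> \<open>A zero of K in the disc is a zero of \<open>bfun \<alpha>\<close>, hence
    positive and at most R, hence in A, where simplicity excludes it.\<close>
  have K0: "K z \<noteq> 0" if z: "z \<in> cball 0 R" for z
  proof (cases "bfun \<alpha> z = 0")
    case True
    with bfun_zero_positive[OF \<alpha>] obtain x where x: "z = of_real x" "x > 0" by auto
    then have "x \<in> A" using z True by (auto simp: A_def bzeros_def)
    then show ?thesis using u2 x by auto
  qed (auto simp: K(2))
  \<comment> \<open>The constant is \<open>1 / (4 * \<alpha>)\<close> from \<open>F' / F\<close>
    plus \<open>1 / (2 * \<alpha>)\<close> from the sum over A.\<close>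
  have "norm (u w - u 0) \<le> 32 / 3 * (3 / (4 * \<alpha>)) / R * norm w" if w: "norm w \<le> R / 4" for w
  proof (rule holomorphic_increment_le[OF R, of "3 / (4 * \<alpha>)" "{z. K z \<noteq> 0}" u w])
    show "open {z. K z \<noteq> 0}"
      using holomorphic_on_imp_continuous_on[OF K(1)] by (intro open_Collect_neq continuous_intros) auto
    show "u holomorphic_on {z. K z \<noteq> 0}"
      unfolding u_def[abs_def]
      by (intro holomorphic_intros holomorphic_on_subset[OF holomorphic_deriv[OF K(1)]] holomorphic_on_subset[OF K(1)]) auto
    show "norm (u z) \<le> 3 / (4 * \<alpha>) * R / \<bar>Im z\<bar>" if z: "norm z = R" "Im z \<noteq> 0" for z
    proof -
      have nz: "bfun \<alpha> z \<noteq> 0" using bfun_zero_positive[OF \<alpha>, of z] z(2) by auto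
      have "norm (bfun (\<alpha> + 1) z) / norm (bfun \<alpha> z) \<le> R / \<bar>Im z\<bar>"
        using norm_bfun_Suc_le_Im[OF \<alpha> z(2)] z(1) nz by (simp add: divide_le_eq)
      then have "norm (bfun (\<alpha> + 1) z) / norm (bfun \<alpha> z) / (4 * \<alpha>) \<le> R / \<bar>Im z\<bar> / (4 * \<alpha>)"
        using \<alpha> by (intro divide_right_mono) auto
      then have 1: "norm (- bfun (\<alpha> + 1) z / (4 * of_real \<alpha> * bfun \<alpha> z)) \<le> R / \<bar>Im z\<bar> / (4 * \<alpha>)"
        using \<alpha> by (simp add: norm_divide norm_mult mult_ac)
      have "norm (\<Sum>a\<in>A. 1 / (z - of_real a)) \<le> (\<Sum>a\<in>A. R / \<bar>Im z\<bar> * (1 / a))"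
      proof (rule sum_norm_le)
        fix a assume a: "a \<in> A"
        have "a > 0" using A0(2)[OF a] .
        moreover have "norm (z - of_real a) > 0" using nz A0(1)[OF a] by auto
        ultimately show "norm (1 / (z - of_real a)) \<le> R / \<bar>Im z\<bar> * (1 / a)"
          using mult_abs_Im_le[of a z] z by (simp add: norm_divide field_simps)
      qed
      also have "\<dots> = R / \<bar>Im z\<bar> * (\<Sum>a\<in>A. 1 / a)" by (simp only: sum_distrib_left)
      also have "\<dots> \<le> R / \<bar>Im z\<bar> * (1 / (2 * \<alpha>))"
        using R finA by (intro mult_left_mono sum_inverse_bzeros_le \<alpha>) (auto simp: A_def)
      finally have 2: "norm (\<Sum>a\<in>A. 1 / (z - of_real a)) \<le> R / \<bar>Im z\<bar> * (1 / (2 * \<alpha>))" .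
      have "norm (u z) \<le> R / \<bar>Im z\<bar> / (4 * \<alpha>) + R / \<bar>Im z\<bar> * (1 / (2 * \<alpha>))"
        unfolding u1[OF nz] by (rule order.trans[OF norm_triangle_ineq4 add_mono[OF 1 2]])
      then show ?thesis using z \<alpha> by (simp add: field_simps)
    qed
  qed (use \<alpha> w K0 in auto)
  then show ?thesis using u1 u2 by (intro that[of u]) auto
qed

subsection \<open>The negative axis\<close>

text \<open>For \<alpha> > 0 this is \<open>bfun \<alpha>\<close> at \<open>- t\<close>, so
  \<open>bmod \<alpha> (x^2)\<close> is the modified Bessel function of order
  \<open>\<alpha> - 1\<close> at x, normalised to 1 at 0.\<close>

definition bmod :: "real \<Rightarrow> real \<Rightarrow> real" where
  "bmod \<alpha> t = (\<Sum>j. \<bar>bcoef \<alpha> j\<bar> * t ^ j)"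

lemma abs_bcoef: "\<alpha> > 0 \<Longrightarrow> \<bar>bcoef \<alpha> j\<bar> = (-1) ^ j * bcoef \<alpha> j"
  by (simp add: bcoef_def power_minus[of "1/4"] abs_mult power_abs pochhammer_nonneg)

lemma bfun_minus_of_real:
  assumes "\<alpha> > 0"
  shows "bfun \<alpha> (- of_real t) = of_real (bmod \<alpha> t)"
proof -
  have "bfun \<alpha> (- of_real t) = (\<Sum>j. of_real (\<bar>bcoef \<alpha> j\<bar> * t ^ j))"
    unfolding bfun_def abs_bcoef[OF assms]
    by (intro suminf_cong) (simp add: power_minus[of "of_real t"] mult_ac)
  also have "\<dots> = of_real (bmod \<alpha> t)"
    unfolding bmod_def by (rule suminf_of_real[OF summable_abs_bcoef[OF assms], symmetric])
  finally show ?thesis .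
qed

lemma bmod_ge_1:
  assumes "\<alpha> > 0" "t \<ge> 0"
  shows "bmod \<alpha> t \<ge> 1"
proof -
  have "(\<Sum>j\<in>{0}. \<bar>bcoef \<alpha> j\<bar> * t ^ j) \<le> bmod \<alpha> t"
    unfolding bmod_def using assms by (intro sum_le_suminf summable_abs_bcoef) auto
  then show ?thesis by (simp add: bcoef_def)
qed

lemma bmod_contiguous:
  assumes "\<alpha> > 0"
  shows "bmod \<alpha> t - bmod (\<alpha> + 1) t = t * bmod (\<alpha> + 2) t / (4 * \<alpha> * (\<alpha> + 1))"
proof -
  have "complex_of_real (bmod (\<alpha> + 1) t - bmod \<alpha> t) = of_real (- t * bmod (\<alpha> + 2) t / (4 * \<alpha> * (\<alpha> + 1)))"
    using bfun_contiguous[OF assms, of "- of_real t"] assms by (simp add: bfun_minus_of_real)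
  then show ?thesis unfolding of_real_eq_iff by simp
qed

lemma abs_bcoef_Suc_param:
  assumes "\<alpha> > 0"
  shows "\<bar>bcoef (\<alpha> + 1) j\<bar> = \<alpha> / (\<alpha> + real j) * \<bar>bcoef \<alpha> j\<bar>"
proof -
  have p: "pochhammer \<alpha> j > 0" using assms by (rule pochhammer_pos)
  have "\<alpha> * pochhammer (\<alpha> + 1) j = pochhammer \<alpha> j * (\<alpha> + real j)"
    using pochhammer_rec[of \<alpha> j] pochhammer_Suc[of \<alpha> j] by simp
  then have e: "pochhammer (\<alpha> + 1) j = pochhammer \<alpha> j * (\<alpha> + real j) / \<alpha>"
    using assms by (simp add: field_simps)
  show ?thesis using assms p unfolding bcoef_def e by (simp add: abs_mult power_abs mult_ac)
qed

text \<open>The coefficients of the three series are in the ratio \<open>x : 1 : y x\<close> with \<open>x \<le> y\<close>, and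
  \<open>x \<le> \<epsilon> + x\<^sup>2 / (4 \<epsilon>)\<close>.\<close>

lemma bmod_Suc_le:
  assumes \<alpha>: "\<alpha> > 0" and "t \<ge> 0" and \<epsilon>: "\<epsilon> > 0"
  shows "bmod (\<alpha> + 1) t \<le> \<epsilon> * bmod \<alpha> t + bmod (\<alpha> + 2) t / (4 * \<epsilon>)"
proof -
  have s: "summable (\<lambda>j. \<bar>bcoef \<alpha> j\<bar> * t ^ j)" "summable (\<lambda>j. \<bar>bcoef (\<alpha> + 1) j\<bar> * t ^ j)"
     "summable (\<lambda>j. \<bar>bcoef (\<alpha> + 2) j\<bar> * t ^ j)" using \<alpha> by (auto intro!: summable_abs_bcoef)
  have le: "\<bar>bcoef (\<alpha> + 1) j\<bar> * t ^ j \<le> \<epsilon> * (\<bar>bcoef \<alpha> j\<bar> * t ^ j) + 1 / (4 * \<epsilon>) * (\<bar>bcoef (\<alpha> + 2) j\<bar> * t ^ j)" for j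
  proof -
    define x where "x = \<alpha> / (\<alpha> + real j)"
    define y where "y = (\<alpha> + 1) / (\<alpha> + 1 + real j)"
    have x: "x > 0" using \<alpha> by (simp add: x_def)
    have xy: "x \<le> y" using \<alpha> by (simp add: x_def y_def field_simps)
    have "0 \<le> (2 * \<epsilon> - x)\<^sup>2" by simp
    then have "x \<le> \<epsilon> + 1 / (4 * \<epsilon>) * (x * x)" using \<epsilon> by (simp add: power2_eq_square field_simps)
    also have "\<dots> \<le> \<epsilon> + 1 / (4 * \<epsilon>) * (y * x)"
      using \<epsilon> x xy by (intro add_left_mono mult_left_mono mult_right_mono) auto
    finally have "x * (\<bar>bcoef \<alpha> j\<bar> * t ^ j) \<le> (\<epsilon> + 1 / (4 * \<epsilon>) * (y * x)) * (\<bar>bcoef \<alpha> j\<bar> * t ^ j)"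
      using assms(2) by (intro mult_right_mono) auto
    moreover have "\<bar>bcoef (\<alpha> + 2) j\<bar> = y * x * \<bar>bcoef \<alpha> j\<bar>"
      using abs_bcoef_Suc_param[of "\<alpha> + 1" j] abs_bcoef_Suc_param[OF \<alpha>, of j] \<alpha> by (simp add: x_def y_def add.assoc)
    ultimately show ?thesis
      using abs_bcoef_Suc_param[OF \<alpha>, of j] by (simp add: x_def algebra_simps)
  qed
  have "bmod (\<alpha> + 1) t \<le> (\<Sum>j. \<epsilon> * (\<bar>bcoef \<alpha> j\<bar> * t ^ j) + 1 / (4 * \<epsilon>) * (\<bar>bcoef (\<alpha> + 2) j\<bar> * t ^ j))"
    unfolding bmod_def by (rule suminf_le[OF le s(2)]) (intro summable_add summable_mult s)
  also have "\<dots> = \<epsilon> * bmod \<alpha> t + 1 / (4 * \<epsilon>) * bmod (\<alpha> + 2) t"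
    unfolding bmod_def suminf_mult[OF s(1), symmetric] suminf_mult[OF s(3), symmetric]
    by (rule suminf_add[symmetric]) (intro summable_mult s)+
  finally show ?thesis by simp
qed

text \<open>The contiguous relation and positivity give \<open>bmod (\<alpha> + 2) t \<le> 4 *
  \<epsilon>^2 * bmod \<alpha> t\<close> for this \<epsilon>, which balances the two terms of
  \<open>bmod_Suc_le\<close>.\<close>

lemma bmod_ratio_le:
  assumes \<alpha>: "\<alpha> > 0" and t: "t > 0"
  shows "bmod (\<alpha> + 1) t / bmod \<alpha> t \<le> 2 * sqrt (\<alpha> * (\<alpha> + 1) / t)"
proof -
  define \<epsilon> where "\<epsilon> = sqrt (\<alpha> * (\<alpha> + 1) / t)"
  have \<epsilon>: "\<epsilon> > 0" using \<alpha> t by (simp add: \<epsilon>_def)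
  have e2: "\<epsilon> * \<epsilon> = \<alpha> * (\<alpha> + 1) / t" using \<alpha> t by (simp add: \<epsilon>_def)
  have pos: "bmod \<alpha> t > 0" "bmod (\<alpha> + 1) t > 0"
    using bmod_ge_1[OF \<alpha>, of t] bmod_ge_1[of "\<alpha> + 1" t] \<alpha> t by auto
  have "t * bmod (\<alpha> + 2) t / (4 * \<alpha> * (\<alpha> + 1)) \<le> bmod \<alpha> t"
    using bmod_contiguous[OF \<alpha>, of t] pos by simp
  then have "t * bmod (\<alpha> + 2) t \<le> bmod \<alpha> t * (4 * \<alpha> * (\<alpha> + 1))"
    using \<alpha> by (subst (asm) pos_divide_le_eq) auto
  then have "bmod (\<alpha> + 2) t / 4 \<le> (\<epsilon> * \<epsilon>) * bmod \<alpha> t"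
    unfolding e2 using \<alpha> t by (simp add: field_simps)
  then have "bmod (\<alpha> + 2) t / (4 * \<epsilon>) \<le> \<epsilon> * bmod \<alpha> t" using \<epsilon> by (simp add: field_simps)
  then have "bmod (\<alpha> + 1) t \<le> 2 * \<epsilon> * bmod \<alpha> t"
    using bmod_Suc_le[OF \<alpha> less_imp_le[OF t] \<epsilon>] by simp
  then show ?thesis using pos by (simp add: \<epsilon>_def field_simps)
qed

lemma bmod_ratio_nonneg: "\<alpha> > 0 \<Longrightarrow> t \<ge> 0 \<Longrightarrow> bmod (\<alpha> + 1) t / bmod \<alpha> t \<ge> 0"
  using bmod_ge_1[of \<alpha> t] bmod_ge_1[of "\<alpha> + 1" t] by simp

lemma bmod_ratio_tendsto_0:
  assumes "\<alpha> > 0"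
  shows "((\<lambda>t. bmod (\<alpha> + 1) t / bmod \<alpha> t) \<longlongrightarrow> 0) at_top"
proof (rule tendsto_sandwich[where f = "\<lambda>_. 0" and h = "\<lambda>t. 2 * sqrt (\<alpha> * (\<alpha> + 1) / t)"])
  have "((\<lambda>t. 2 * sqrt (\<alpha> * (\<alpha> + 1) / t)) \<longlongrightarrow> 2 * sqrt 0) at_top"
    by (intro tendsto_intros tendsto_divide_0[OF tendsto_const] filterlim_at_top_imp_at_infinity filterlim_ident)
  then show "((\<lambda>t. 2 * sqrt (\<alpha> * (\<alpha> + 1) / t)) \<longlongrightarrow> 0) at_top" by simp
  show "\<forall>\<^sub>F t in at_top. bmod (\<alpha> + 1) t / bmod \<alpha> t \<le> 2 * sqrt (\<alpha> * (\<alpha> + 1) / t)"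
    using eventually_gt_at_top[of 0] by eventually_elim (rule bmod_ratio_le[OF assms])
  show "\<forall>\<^sub>F t in at_top. 0 \<le> bmod (\<alpha> + 1) t / bmod \<alpha> t"
    using eventually_ge_at_top[of 0] by eventually_elim (rule bmod_ratio_nonneg[OF assms])
qed auto

subsection \<open>Partial fractions\<close>

text \<open>The truncations eventually contain every finite subset of Z. This links unordered sums
  with the limits of truncated sums that the contour bounds deliver.\<close>

lemma has_sum_imp_tendsto_atMost:
  fixes f :: "real \<Rightarrow> real"
  assumes "(f has_sum S) Z" "\<And>R. finite (Z \<inter> {..R})"
  shows "((\<lambda>R. \<Sum>a\<in>Z \<inter> {..R}. f a) \<longlongrightarrow> S) at_top"
proof -
  have "filterlim (\<lambda>R. Z \<inter> {..R}) (finite_subsets_at_top Z) at_top"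
    unfolding filterlim_finite_subsets_at_top
  proof safe
    fix X :: "real set" assume X: "finite X" "X \<subseteq> Z"
    then obtain B where "\<forall>x\<in>X. x \<le> B" by (meson bdd_above.unfold bdd_above_finite)
    then show "\<forall>\<^sub>F R in at_top. finite (Z \<inter> {..R}) \<and> X \<subseteq> Z \<inter> {..R} \<and> Z \<inter> {..R} \<subseteq> Z"
      using X assms(2) by (intro eventually_at_top_linorderI[of B]) force
  qed
  with assms(1) show ?thesis unfolding has_sum_def by (rule filterlim_compose)
qed

lemma summable_inverse_bzeros_plus:
  assumes "\<alpha> > 0" "t \<ge> 0"
  shows "(\<lambda>a. 1 / (a + t)) summable_on bzeros \<alpha>"
  by (rule summable_on_comparison_test[OF summable_inverse_bzeros[OF assms(1)]])
     (use assms(2) in \<open>auto simp: bzeros_def intro!: divide_left_mono\<close>)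

text \<open>A tail of the sum of \<open>1 / a\<close> dominates all but finitely many terms, and
  each of those is at most \<open>1 / t\<close>.\<close>

lemma infsum_bzeros_tendsto_0:
  assumes \<alpha>: "\<alpha> > 0"
  shows "((\<lambda>t. \<Sum>\<^sub>\<infinity>a\<in>bzeros \<alpha>. 1 / (a + t)) \<longlongrightarrow> 0) at_top"
proof (rule order_tendstoI)
  fix e :: real assume "e < 0"
  show "\<forall>\<^sub>F t in at_top. e < (\<Sum>\<^sub>\<infinity>a\<in>bzeros \<alpha>. 1 / (a + t))"
    using eventually_ge_at_top[of 0]
  proof eventually_elim
    case (elim t)
    have "(\<Sum>\<^sub>\<infinity>a\<in>bzeros \<alpha>. 1 / (a + t)) \<ge> 0" using elim by (intro infsum_nonneg) (auto simp: bzeros_def)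
    with \<open>e < 0\<close> show ?case by linarith
  qed
next
  fix e :: real assume e: "e > 0"
  define T where "T = (\<Sum>\<^sub>\<infinity>a\<in>bzeros \<alpha>. 1 / a)"
  have s: "(\<lambda>a. 1 / a) summable_on bzeros \<alpha>" by (rule summable_inverse_bzeros[OF \<alpha>])
  have "((\<lambda>R. \<Sum>a\<in>bzeros \<alpha> \<inter> {..R}. 1 / a) \<longlongrightarrow> T) at_top"
    unfolding T_def by (intro has_sum_imp_tendsto_atMost has_sum_infsum s finite_bzeros_atMost \<alpha>)
  then have "\<forall>\<^sub>F R in at_top. (\<Sum>a\<in>bzeros \<alpha> \<inter> {..R}. 1 / a) > T - e / 2"
    using e by (intro order_tendstoD) auto
  then obtain R where R: "(\<Sum>a\<in>bzeros \<alpha> \<inter> {..R}. 1 / a) > T - e / 2"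
    by (auto dest!: eventually_happens)
  define A where "A = bzeros \<alpha> \<inter> {..R}"
  have A: "finite A" "A \<subseteq> bzeros \<alpha>" unfolding A_def using finite_bzeros_atMost[OF \<alpha>] by auto
  have "((\<lambda>t. real (card A) / t) \<longlongrightarrow> 0) at_top" by real_asymp
  then have "\<forall>\<^sub>F t in at_top. real (card A) / t < e / 2" using e by (intro order_tendstoD) auto
  then show "\<forall>\<^sub>F t in at_top. (\<Sum>\<^sub>\<infinity>a\<in>bzeros \<alpha>. 1 / (a + t)) < e"
    using eventually_gt_at_top[of 0]
  proof eventually_elim
    case (elim t)
    have st: "(\<lambda>a. 1 / (a + t)) summable_on bzeros \<alpha>"
      using elim by (intro summable_inverse_bzeros_plus \<alpha>) auto
    have "(\<Sum>\<^sub>\<infinity>a\<in>bzeros \<alpha> - A. 1 / (a + t)) \<le> (\<Sum>\<^sub>\<infinity>a\<in>bzeros \<alpha> - A. 1 / a)"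
      using elim by (intro infsum_mono summable_on_subset_banach[OF st] summable_on_subset_banach[OF s])
        (auto simp: bzeros_def intro!: divide_left_mono)
    moreover have "(\<Sum>\<^sub>\<infinity>a\<in>bzeros \<alpha> - A. 1 / (a + t)) = (\<Sum>\<^sub>\<infinity>a\<in>bzeros \<alpha>. 1 / (a + t)) - (\<Sum>a\<in>A. 1 / (a + t))"
      using A by (subst infsum_Diff) (auto intro: st)
    moreover have "(\<Sum>\<^sub>\<infinity>a\<in>bzeros \<alpha> - A. 1 / a) = T - (\<Sum>a\<in>A. 1 / a)"
      using A by (subst infsum_Diff) (auto intro: s simp: T_def)
    moreover have "(\<Sum>a\<in>A. 1 / (a + t)) \<le> real (card A) * (1 / t)"
      using A elim by (intro sum_bounded_above) (auto simp: bzeros_def intro!: divide_left_mono)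
    moreover have "real (card A) * (1 / t) < e / 2" using elim by simp
    ultimately show ?case using R[folded A_def] by linarith
  qed
qed

text \<open>Between fixed points \<open>u R\<close> varies by \<open>O(1 / R)\<close>, so its limit
  takes one value at 0, at \<open>- t\<close> and at b. The second claim is at first only a limit of
  truncations, as absolute convergence is shown separately.\<close>

lemma bzeros_partial_fractions:
  assumes \<alpha>: "\<alpha> > 0"
  shows "t \<ge> 0 \<Longrightarrow> (\<Sum>\<^sub>\<infinity>a\<in>bzeros \<alpha>. 1 / (a + t)) = bmod (\<alpha> + 1) t / (4 * \<alpha> * bmod \<alpha> t)"
    and "b \<in> bzeros \<alpha> \<Longrightarrow>
      ((\<lambda>R. \<Sum>a\<in>(bzeros \<alpha> - {b}) \<inter> {..R}. 1 / (b - a)) \<longlongrightarrow> - \<alpha> / (2 * b)) at_top"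
proof -
  define A where "A R = bzeros \<alpha> \<inter> {..R}" for R
  define T where "T t = (\<Sum>\<^sub>\<infinity>a\<in>bzeros \<alpha>. 1 / (a + t))" for t
  define v where "v t = bmod (\<alpha> + 1) t / bmod \<alpha> t" for t
  define \<psi> where "\<psi> R t = (\<Sum>a\<in>A R. 1 / (a + t)) - v t / (4 * \<alpha>)" for R t
  have \<psi>: "((\<lambda>R. \<psi> R t) \<longlongrightarrow> T t - v t / (4 * \<alpha>)) at_top" if "t \<ge> 0" for t
    unfolding \<psi>_def A_def T_def
    by (intro tendsto_intros has_sum_imp_tendsto_atMost has_sum_infsum
          summable_inverse_bzeros_plus finite_bzeros_atMost \<alpha> that)
  have lim0: "((\<lambda>R. 8 / \<alpha> / R * t) \<longlongrightarrow> 0) at_top" for t by real_asymp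
  obtain u where u: "\<And>R w. R > 0 \<Longrightarrow> bfun \<alpha> w \<noteq> 0 \<Longrightarrow>
       u R w = - bfun (\<alpha> + 1) w / (4 * of_real \<alpha> * bfun \<alpha> w) - (\<Sum>a\<in>A R. 1 / (w - of_real a))"
    "\<And>R b. R > 0 \<Longrightarrow> b \<in> A R \<Longrightarrow> u R (of_real b) = of_real (- \<alpha> / (2 * b) - (\<Sum>a\<in>A R - {b}. 1 / (b - a)))"
    "\<And>R w. R > 0 \<Longrightarrow> norm w \<le> R / 4 \<Longrightarrow> norm (u R w - u R 0) \<le> 8 / \<alpha> / R * norm w"
  proof -
    have "\<forall>R. \<exists>u. R > 0 \<longrightarrow> (\<forall>w. bfun \<alpha> w \<noteq> 0 \<longrightarrow>
        u w = - bfun (\<alpha> + 1) w / (4 * of_real \<alpha> * bfun \<alpha> w) - (\<Sum>a\<in>A R. 1 / (w - of_real a))) \<and>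
      (\<forall>b\<in>A R. u (of_real b) = of_real (- \<alpha> / (2 * b) - (\<Sum>a\<in>A R - {b}. 1 / (b - a)))) \<and>
      (\<forall>w. norm w \<le> R / 4 \<longrightarrow> norm (u w - u 0) \<le> 8 / \<alpha> / R * norm w)"
      unfolding A_def using log_deriv_remainder[OF \<alpha>] by metis
    then show ?thesis using that by metis
  qed
  have upos: "u R (- of_real t) = of_real (\<psi> R t)" if "R > 0" "t \<ge> 0" for R t
  proof -
    have "bmod \<alpha> t \<noteq> 0" using bmod_ge_1[OF \<alpha> that(2)] by simp
    then have "u R (- of_real t) = - of_real (bmod (\<alpha> + 1) t) / (4 * of_real \<alpha> * of_real (bmod \<alpha> t))
        - (\<Sum>a\<in>A R. 1 / (- of_real t - of_real a))"
      using u(1)[OF that(1), of "- of_real t"] \<alpha> by (simp add: bfun_minus_of_real)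
    also have "(\<Sum>a\<in>A R. 1 / (- of_real t - of_real a)) = - complex_of_real (\<Sum>a\<in>A R. 1 / (a + t))"
      unfolding of_real_sum sum_negf[symmetric]
      by (intro sum.cong) (auto simp: minus_divide_right)
    finally show ?thesis by (simp add: \<psi>_def v_def mult_ac)
  qed
  have const: "T t - v t / (4 * \<alpha>) = T 0 - v 0 / (4 * \<alpha>)" if t: "t \<ge> 0" for t
  proof -
    have l1: "((\<lambda>R. \<psi> R t - \<psi> R 0) \<longlongrightarrow> 0) at_top"
    proof (rule Lim_null_comparison[OF _ lim0[of t]])
      show "\<forall>\<^sub>F R in at_top. norm (\<psi> R t - \<psi> R 0) \<le> 8 / \<alpha> / R * t"
        using eventually_gt_at_top[of 0] eventually_ge_at_top[of "4 * t"]
      proof eventually_elim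
        case (elim R)
        have "norm (\<psi> R t - \<psi> R 0) = norm (complex_of_real (\<psi> R t - \<psi> R 0))" by (simp only: norm_of_real real_norm_def)
        also have "\<dots> = norm (u R (- of_real t) - u R 0)"
          using upos[OF elim(1) t] upos[OF elim(1), of 0] by simp
        finally show ?case using u(3)[OF elim(1), of "- of_real t"] elim t by simp
      qed
    qed
    have l2: "((\<lambda>R. \<psi> R t - \<psi> R 0) \<longlongrightarrow> (T t - v t / (4 * \<alpha>)) - (T 0 - v 0 / (4 * \<alpha>))) at_top"
      by (intro tendsto_diff \<psi> t) auto
    from tendsto_unique[OF trivial_limit_at_top_linorder l1 l2] show ?thesis by simp
  qed
  \<comment> \<open>The constant is identified by letting \<open>t\<close> tend to infinity.\<close>
  have l1: "((\<lambda>t. T t - v t / (4 * \<alpha>)) \<longlongrightarrow> 0 - 0 / (4 * \<alpha>)) at_top"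
    unfolding T_def v_def
    by (intro tendsto_intros infsum_bzeros_tendsto_0 bmod_ratio_tendsto_0) (use \<alpha> in auto)
  have l2: "((\<lambda>t. T t - v t / (4 * \<alpha>)) \<longlongrightarrow> T 0 - v 0 / (4 * \<alpha>)) at_top"
    by (intro tendsto_eventually eventually_mono[OF eventually_ge_at_top[of 0]] const)
  have c0: "T 0 - v 0 / (4 * \<alpha>) = 0"
    using tendsto_unique[OF trivial_limit_at_top_linorder l1 l2] by simp
  show "(\<Sum>\<^sub>\<infinity>a\<in>bzeros \<alpha>. 1 / (a + t)) = bmod (\<alpha> + 1) t / (4 * \<alpha> * bmod \<alpha> t)" if "t \<ge> 0"
    using const[OF that] c0 by (simp add: T_def v_def mult_ac)
  assume b: "b \<in> bzeros \<alpha>"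
  then have bpos: "b > 0" by (simp add: bzeros_def)
  have A_eq: "A R - {b} = (bzeros \<alpha> - {b}) \<inter> {..R}" for R by (auto simp: A_def)
  \<comment> \<open>This is \<open>u R\<close> at b minus \<open>u R\<close> at 0, and the latter
    tends to the constant already shown to be 0.\<close>
  have "((\<lambda>R. - \<alpha> / (2 * b) - (\<Sum>a\<in>A R - {b}. 1 / (b - a)) - \<psi> R 0) \<longlongrightarrow> 0) at_top"
  proof (rule Lim_null_comparison[OF _ lim0[of b]])
    show "\<forall>\<^sub>F R in at_top. norm (- \<alpha> / (2 * b) - (\<Sum>a\<in>A R - {b}. 1 / (b - a)) - \<psi> R 0) \<le> 8 / \<alpha> / R * b"
      using eventually_ge_at_top[of "4 * b"]
    proof eventually_elim
      case (elim R)
      have R: "R > 0" using elim bpos by simp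
      have bA: "b \<in> A R" using b elim bpos by (simp add: A_def)
      have "norm (- \<alpha> / (2 * b) - (\<Sum>a\<in>A R - {b}. 1 / (b - a)) - \<psi> R 0)
         = norm (complex_of_real (- \<alpha> / (2 * b) - (\<Sum>a\<in>A R - {b}. 1 / (b - a)) - \<psi> R 0))"
        by (simp only: norm_of_real real_norm_def)
      also have "\<dots> = norm (u R (of_real b) - u R 0)"
        unfolding u(2)[OF R bA] using upos[OF R, of 0] by simp
      finally show ?case using u(3)[OF R, of "of_real b"] elim bpos by simp
    qed
  qed
  from tendsto_add[OF this \<psi>[of 0]] c0
  have "((\<lambda>R. - \<alpha> / (2 * b) - (\<Sum>a\<in>A R - {b}. 1 / (b - a))) \<longlongrightarrow> 0) at_top" by simp
  from tendsto_diff[OF tendsto_const[of "- \<alpha> / (2 * b)"] this]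
  show "((\<lambda>R. \<Sum>a\<in>(bzeros \<alpha> - {b}) \<inter> {..R}. 1 / (b - a)) \<longlongrightarrow> - \<alpha> / (2 * b)) at_top"
    by (simp add: A_eq)
qed

text \<open>With finitely many zeros, \<open>t v\<^sub>\<alpha>(t)\<close> would stay bounded, where \<open>v\<^sub>\<alpha>\<close> is the ratio
  \<open>bmod (\<alpha> + 1) / bmod \<alpha>\<close>; but \<open>1 - v\<^sub>\<alpha> = t v\<^sub>\<alpha> v\<^bsub>\<alpha>+1\<^esub> / (4 \<alpha> (\<alpha> + 1))\<close> and \<open>v \<rightarrow> 0\<close>.\<close>

lemma infinite_bzeros:
  assumes \<alpha>: "\<alpha> > 0"
  shows "infinite (bzeros \<alpha>)"
proof
  assume fin: "finite (bzeros \<alpha>)"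
  define v where "v \<beta> t = bmod (\<beta> + 1) t / bmod \<beta> t" for \<beta> t
  define N where "N = real (card (bzeros \<alpha>))"
  have "\<forall>\<^sub>F t in at_top. 1 - v \<alpha> t \<le> N * v (\<alpha> + 1) t / (\<alpha> + 1)"
    using eventually_gt_at_top[of 0]
  proof eventually_elim
    case (elim t)
    have pos: "bmod \<alpha> t > 0" "bmod (\<alpha> + 1) t > 0" "bmod (\<alpha> + 2) t > 0"
      using bmod_ge_1[OF \<alpha>, of t] bmod_ge_1[of "\<alpha> + 1" t] bmod_ge_1[of "\<alpha> + 2" t] \<alpha> elim by auto
    have "v \<alpha> t / (4 * \<alpha>) = (\<Sum>a\<in>bzeros \<alpha>. 1 / (a + t))"
      using bzeros_partial_fractions(1)[OF \<alpha>, of t] fin elim by (simp add: v_def mult_ac)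
    also have "\<dots> \<le> N * (1 / t)"
      unfolding N_def using elim by (intro sum_bounded_above) (auto simp: bzeros_def intro!: divide_left_mono)
    finally have "t * v \<alpha> t / (4 * \<alpha>) \<le> N" using elim \<alpha> by (simp add: field_simps)
    then have "t * v \<alpha> t / (4 * \<alpha>) * (v (\<alpha> + 1) t / (\<alpha> + 1)) \<le> N * (v (\<alpha> + 1) t / (\<alpha> + 1))"
      unfolding v_def using \<alpha> elim by (intro mult_right_mono divide_nonneg_pos[OF bmod_ratio_nonneg]) auto
    moreover have "1 - v \<alpha> t = t * v \<alpha> t / (4 * \<alpha>) * (v (\<alpha> + 1) t / (\<alpha> + 1))"
    proof -
      have "1 - v \<alpha> t = (bmod \<alpha> t - bmod (\<alpha> + 1) t) / bmod \<alpha> t" using pos by (simp add: v_def field_simps)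
      also have "\<dots> = t * v \<alpha> t / (4 * \<alpha>) * (v (\<alpha> + 1) t / (\<alpha> + 1))"
        unfolding bmod_contiguous[OF \<alpha>] using pos by (simp add: v_def add.assoc)
      finally show ?thesis .
    qed
    ultimately show ?case by simp
  qed
  moreover have "((\<lambda>t. 1 - v \<alpha> t) \<longlongrightarrow> 1 - 0) at_top"
    unfolding v_def by (intro tendsto_intros bmod_ratio_tendsto_0 \<alpha>)
  moreover have "((\<lambda>t. N * v (\<alpha> + 1) t / (\<alpha> + 1)) \<longlongrightarrow> N * 0 / (\<alpha> + 1)) at_top"
    unfolding v_def using \<alpha> by (intro tendsto_intros bmod_ratio_tendsto_0) auto
  ultimately have "1 - 0 \<le> N * 0 / (\<alpha> + 1)"
    by (intro tendsto_le[OF trivial_limit_at_top_linorder]) auto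
  then show False by simp
qed

text \<open>Beyond \<open>2 * b\<close> one has \<open>a - b \<ge> a / 2\<close>, so
  \<open>2 / a\<close> dominates; only finitely many zeros remain.\<close>

lemma summable_inverse_bzeros_minus:
  assumes \<alpha>: "\<alpha> > 0" and b: "b \<in> bzeros \<alpha>"
  shows "(\<lambda>a. 1 / (b - a)) summable_on (bzeros \<alpha> - {b})"
proof -
  have b0: "b > 0" using b by (simp add: bzeros_def)
  have "(\<lambda>a. 1 / (a - b)) summable_on (bzeros \<alpha> - {..2 * b})"
  proof (rule summable_on_comparison_test)
    show "(\<lambda>a. 2 * (1 / a)) summable_on (bzeros \<alpha> - {..2 * b})"
      by (intro summable_on_cmult_right summable_on_subset_banach[OF summable_inverse_bzeros[OF \<alpha>]]) auto
  qed (use b0 in \<open>auto simp: field_simps\<close>)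
  then have "(\<lambda>a. - (1 / (a - b))) summable_on (bzeros \<alpha> - {..2 * b})"
    by (simp only: summable_on_uminus)
  then have "(\<lambda>a. 1 / (b - a)) summable_on (bzeros \<alpha> - {..2 * b})"
    by (simp add: minus_divide_right)
  moreover have "(\<lambda>a. 1 / (b - a)) summable_on (bzeros \<alpha> \<inter> {..2 * b} - {b})"
    using finite_bzeros_atMost[OF \<alpha>] by simp
  moreover have "bzeros \<alpha> - {b} = (bzeros \<alpha> - {..2 * b}) \<union> (bzeros \<alpha> \<inter> {..2 * b} - {b})"
    using b0 by auto
  ultimately show ?thesis by (metis (no_types, lifting) Diff_disjoint Diff_subset Int_Diff inf.coboundedI2 Int_commute disjoint_eq_subset_Compl summable_on_union)
qed

text \<open>The sum of \<open>1 / (a + b)\<close> includes a = b; removing that term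
  \<open>1 / (2 * b)\<close> turns \<alpha> into \<open>\<alpha> + 1\<close> in the last
  summand.\<close>

lemma bzeros_sum_diff_squares:
  assumes \<alpha>: "\<alpha> > 0" and b: "b \<in> bzeros \<alpha>"
  shows "((\<lambda>a. 1 / (a\<^sup>2 - b\<^sup>2)) has_sum
     (- 1 / (2 * b) * (\<Sum>\<^sub>\<infinity>a\<in>bzeros \<alpha>. 1 / (a + b)) + (\<alpha> + 1) / (4 * b\<^sup>2))) (bzeros \<alpha> - {b})"
proof -
  define T where "T = (\<Sum>\<^sub>\<infinity>a\<in>bzeros \<alpha>. 1 / (a + b))"
  have b0: "b > 0" using b by (simp add: bzeros_def)
  have "((\<lambda>a. 1 / (b - a)) has_sum (- \<alpha> / (2 * b))) (bzeros \<alpha> - {b})"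
  proof -
    obtain S where S: "((\<lambda>a. 1 / (b - a)) has_sum S) (bzeros \<alpha> - {b})"
      using summable_inverse_bzeros_minus[OF assms] by (auto simp: summable_on_def)
    have "finite ((bzeros \<alpha> - {b}) \<inter> {..R})" for R
      by (rule finite_subset[OF _ finite_bzeros_atMost[OF \<alpha>, of R]]) auto
    from has_sum_imp_tendsto_atMost[OF S this] bzeros_partial_fractions(2)[OF assms]
    have "S = - \<alpha> / (2 * b)" by (rule tendsto_unique[rotated]) simp
    with S show ?thesis by simp
  qed
  moreover have "((\<lambda>a. 1 / (a + b)) has_sum (T - 1 / (b + b))) (bzeros \<alpha> - {b})"
    unfolding T_def using b b0
    by (intro has_sum_Diff has_sum_infsum summable_inverse_bzeros_plus \<alpha>) (auto intro: has_sum_finiteI)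
  ultimately have "((\<lambda>a. - 1 / (2 * b) * (1 / (b - a) + 1 / (a + b))) has_sum
      - 1 / (2 * b) * (- \<alpha> / (2 * b) + (T - 1 / (b + b)))) (bzeros \<alpha> - {b})"
    by (intro has_sum_cmult_right has_sum_add)
  also have "- 1 / (2 * b) * (- \<alpha> / (2 * b) + (T - 1 / (b + b))) = - 1 / (2 * b) * T + (\<alpha> + 1) / (4 * b\<^sup>2)"
    using b0 by (simp add: field_simps power2_eq_square)
  also have "((\<lambda>a. - 1 / (2 * b) * (1 / (b - a) + 1 / (a + b))) has_sum (- 1 / (2 * b) * T + (\<alpha> + 1) / (4 * b\<^sup>2))) (bzeros \<alpha> - {b})
     \<longleftrightarrow> ((\<lambda>a. 1 / (a\<^sup>2 - b\<^sup>2)) has_sum (- 1 / (2 * b) * T + (\<alpha> + 1) / (4 * b\<^sup>2))) (bzeros \<alpha> - {b})"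
  proof (rule has_sum_cong)
    fix a assume "a \<in> bzeros \<alpha> - {b}"
    then have "a > 0" "a \<noteq> b" by (auto simp: bzeros_def)
    then have nz: "b - a \<noteq> 0" "a + b \<noteq> 0" "b \<noteq> 0" using b0 by auto
    have e: "a\<^sup>2 - b\<^sup>2 = - ((b - a) * (a + b))" by (simp add: power2_eq_square algebra_simps)
    show "- 1 / (2 * b) * (1 / (b - a) + 1 / (a + b)) = 1 / (a\<^sup>2 - b\<^sup>2)"
      unfolding e add_divide_eq_iff[OF nz(1)] using nz by (simp add: divide_simps)
  qed
  finally show ?thesis by (simp add: T_def)
qed

subsection \<open>Enumerating the zeros of the Bessel function\<close>

text \<open>\<open>Gamma (m + \<nu> + 1)\<close> is \<open>Gamma (\<nu> + 1)\<close> times a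
  Pochhammer symbol, so the prefactor leaves the series.\<close>

lemma bessel_J_eq_bfun:
  assumes \<nu>: "\<nu> > -1" and x: "x > 0"
  shows "complex_of_real (bessel_J \<nu> x) = of_real ((x / 2) powr \<nu> / Gamma (\<nu> + 1)) * bfun (\<nu> + 1) (of_real (x\<^sup>2))"
proof -
  define c where "c = (x / 2) powr \<nu> / Gamma (\<nu> + 1)"
  have \<alpha>: "\<nu> + 1 > 0" using \<nu> by simp
  have G: "Gamma (\<nu> + 1) > 0" using \<alpha> by (rule Gamma_real_pos)
  have s: "summable (\<lambda>m. bcoef (\<nu> + 1) m * (x\<^sup>2) ^ m)"
    by (rule summable_rabs_cancel) (use summable_abs_bcoef[OF \<alpha>, of "x\<^sup>2"] in \<open>simp add: abs_mult\<close>)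
  have "(-1) ^ m * (x / 2) powr (2 * real m + \<nu>) / (fact m * Gamma (real m + \<nu> + 1))
      = c * (bcoef (\<nu> + 1) m * (x\<^sup>2) ^ m)" for m
  proof -
    have p: "pochhammer (\<nu> + 1) m = Gamma (\<nu> + 1 + real m) / Gamma (\<nu> + 1)"
      using \<alpha> by (intro pochhammer_Gamma) (auto elim!: nonpos_Ints_cases)
    then have "Gamma (real m + \<nu> + 1) = pochhammer (\<nu> + 1) m * Gamma (\<nu> + 1)"
      using G by (simp add: add_ac)
    moreover have "(x / 2) powr (2 * real m + \<nu>) = (x\<^sup>2) ^ m / 4 ^ m * (x / 2) powr \<nu>"
    proof -
      have "(x / 2) powr (2 * real m) = (x / 2) powr (real (2 * m))" by simp
      also have "\<dots> = (x / 2) ^ (2 * m)" using x by (intro powr_realpow) simp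
      also have "\<dots> = (x\<^sup>2) ^ m / 4 ^ m" unfolding power_mult by (simp add: power_divide)
      finally show ?thesis by (simp add: powr_add)
    qed
    ultimately show ?thesis
      by (simp add: c_def bcoef_def power_divide power_minus[of "1/4"] mult_ac)
  qed
  then have "bessel_J \<nu> x = c * (\<Sum>m. bcoef (\<nu> + 1) m * (x\<^sup>2) ^ m)"
    unfolding bessel_J_def by (simp only: suminf_mult[OF s])
  moreover have "bfun (\<nu> + 1) (of_real (x\<^sup>2)) = of_real (\<Sum>m. bcoef (\<nu> + 1) m * (x\<^sup>2) ^ m)"
    unfolding bfun_def suminf_of_real[OF s] by simp
  ultimately show ?thesis by (simp add: c_def)
qed

lemma bessel_J_zero_iff:
  assumes "\<nu> > -1" "x > 0"
  shows "bessel_J \<nu> x = 0 \<longleftrightarrow> x\<^sup>2 \<in> bzeros (\<nu> + 1)"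
proof -
  have "Gamma (\<nu> + 1) > 0" using assms(1) by (intro Gamma_real_pos) simp
  moreover have "bessel_J \<nu> x = 0 \<longleftrightarrow> complex_of_real (bessel_J \<nu> x) = 0" by simp
  ultimately show ?thesis
    unfolding bessel_J_eq_bfun[OF assms] using assms(2) by (simp add: bzeros_def)
qed

text \<open>\<open>bessel_J_zero\<close> inverts a counting function, so that function must be a
  bijection. It is strictly increasing on B, and since B is infinite and locally finite every
  element has a successor.\<close>

lemma bij_betw_rank:
  fixes B :: "real set"
  assumes inf: "infinite B" and fin: "\<And>R. finite (B \<inter> {..R})" and pos: "\<And>x. x \<in> B \<Longrightarrow> x > 0"
  shows "bij_betw (\<lambda>x. card (B \<inter> {..x})) B {n. n \<ge> 1}"
proof -
  define rk where "rk x = card (B \<inter> {..x})" for x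
  have less: "rk x < rk y" if "y \<in> B" "x < y" for x y
  proof -
    have "y \<in> B \<inter> {..y}" "y \<notin> B \<inter> {..x}" "B \<inter> {..x} \<subseteq> B \<inter> {..y}" using that by auto
    then have "B \<inter> {..x} \<subset> B \<inter> {..y}" by blast
    then show ?thesis unfolding rk_def by (rule psubset_card_mono[OF fin])
  qed
  have inj: "inj_on rk B"
  proof (rule inj_onI)
    fix x y assume "x \<in> B" "y \<in> B" "rk x = rk y"
    then show "x = y" using less[of x y] less[of y x] by (cases x y rule: linorder_cases) auto
  qed
  have ge1: "rk x \<ge> 1" if "x \<in> B" for x
    using that fin[of x] by (auto simp: rk_def Suc_le_eq card_gt_0_iff)
  have "\<exists>x\<in>B. rk x = Suc (rk y)" for y
  proof -
    have "infinite (B - B \<inter> {..y})" using inf fin[of y] by simp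
    then obtain z where z: "z \<in> B - B \<inter> {..y}" using infinite_imp_nonempty by blast
    \<comment> \<open>Cutting off at some z beyond y makes the set finite, so that the next element
      exists as a minimum.\<close>
    define X where "X = B \<inter> {y<..z}"
    have X: "finite X" "X \<noteq> {}" using z unfolding X_def by (auto intro: finite_subset[OF _ fin[of z]])
    define m where "m = Min X"
    have m: "m \<in> X" "\<And>a. a \<in> X \<Longrightarrow> m \<le> a" using X by (auto simp: m_def)
    have "B \<inter> {..m} = insert m (B \<inter> {..y})"
      using m(1) m(2) by (force simp: X_def)
    then have "rk m = Suc (rk y)" unfolding rk_def using fin[of y] m(1) by (simp add: X_def)
    then show ?thesis using m(1) by (auto simp: X_def)
  qed
  note step = this
  have "\<exists>x\<in>B. rk x = Suc n" for n
  proof (induction n)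
    case 0
    \<comment> \<open>Rank 0 is attained at 0, outside B; its successor is the least
      element.\<close>
    have "B \<inter> {..0} = {}" using pos by fastforce
    then have "rk 0 = 0" by (simp add: rk_def)
    then show ?case using step[of 0] by simp
  next
    case (Suc n)
    then show ?case using step by metis
  qed
  then have "{n. n \<ge> 1} \<subseteq> rk ` B"
    by (auto simp: image_iff) (metis Suc_le_D One_nat_def)
  then show ?thesis
    using inj ge1 unfolding bij_betw_def rk_def[abs_def] by auto
qed

lemma bij_betw_bessel_J_zero:
  assumes \<nu>: "\<nu> > -1"
  shows "bij_betw (\<lambda>n. (bessel_J_zero \<nu> n)\<^sup>2) {n. n \<ge> 1} (bzeros (\<nu> + 1))"
proof -
  have \<alpha>: "\<nu> + 1 > 0" using \<nu> by simp
  define B where "B = {x. 0 < x \<and> bessel_J \<nu> x = 0}"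
  have sq: "bij_betw (\<lambda>x. x\<^sup>2) B (bzeros (\<nu> + 1))"
  proof (rule bij_betw_byWitness[where f' = sqrt])
    show "(\<lambda>x. x\<^sup>2) ` B \<subseteq> bzeros (\<nu> + 1)" using bessel_J_zero_iff[OF \<nu>] by (auto simp: B_def)
    show "sqrt ` bzeros (\<nu> + 1) \<subseteq> B"
    proof safe
      fix y assume y: "y \<in> bzeros (\<nu> + 1)"
      then have "y > 0" by (simp add: bzeros_def)
      with y show "sqrt y \<in> B" using bessel_J_zero_iff[OF \<nu>, of "sqrt y"] by (simp add: B_def)
    qed
  qed (auto simp: B_def bzeros_def)
  have "bij_betw (\<lambda>x. card (B \<inter> {..x})) B {n. n \<ge> 1}"
  proof (rule bij_betw_rank)
    show "infinite B" using bij_betw_finite[OF sq] infinite_bzeros[OF \<alpha>] by simp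
    show "finite (B \<inter> {..R})" for R
    proof (rule inj_on_finite)
      show "inj_on (\<lambda>x. x\<^sup>2) (B \<inter> {..R})" using sq by (auto simp: bij_betw_def intro: inj_on_subset)
      show "(\<lambda>x. x\<^sup>2) ` (B \<inter> {..R}) \<subseteq> bzeros (\<nu> + 1) \<inter> {..R\<^sup>2}"
        using sq by (auto simp: bij_betw_def B_def intro!: power_mono)
    qed (rule finite_bzeros_atMost[OF \<alpha>])
  qed (auto simp: B_def)
  from bij_betw_the_inv_into[OF this]
  have "bij_betw (the_inv_into B (\<lambda>x. card (B \<inter> {..x}))) {n. n \<ge> 1} B" .
  \<comment> \<open>Both sides unfold to the same definite description.\<close>
  moreover have "the_inv_into B (\<lambda>x. card (B \<inter> {..x})) = bessel_J_zero \<nu>"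
  proof
    fix n
    have "B \<inter> {..x} = {y. 0 < y \<and> y \<le> x \<and> bessel_J \<nu> y = 0}" for x by (auto simp: B_def)
    then show "the_inv_into B (\<lambda>x. card (B \<inter> {..x})) n = bessel_J_zero \<nu> n"
      unfolding the_inv_into_def bessel_J_zero_def by (simp add: B_def conj_assoc)
  qed
  ultimately have "bij_betw (bessel_J_zero \<nu>) {n. n \<ge> 1} B" by simp
  from bij_betw_trans[OF this sq] show ?thesis by (simp add: o_def)
qed

lemma bij_betw_remove1:
  assumes "bij_betw g A Z" "k \<in> A"
  shows "bij_betw g (A - {k}) (Z - {g k})"
  using assms by (auto simp: bij_betw_def inj_on_def)

subsection \<open>Half-integer parameters\<close>

text \<open>Only even terms of the cosine series survive, and
  \<open>(2 j)! = 4^j * pochhammer (1/2) j * j!\<close> matches the coefficients.\<close>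

lemma bfun_half:
  "bfun (1/2) (z\<^sup>2) = cos z"
proof -
  have "(\<lambda>n. cos_coeff n *\<^sub>R z ^ n) sums cos z" by (rule cos_converges)
  then have "(\<lambda>j. cos_coeff (2 * j) *\<^sub>R z ^ (2 * j)) sums cos z"
    by (subst sums_mono_reindex[of "\<lambda>j. 2 * j" "\<lambda>n. cos_coeff n *\<^sub>R z ^ n"])
       (auto simp: strict_mono_def cos_coeff_def elim!: evenE)
  moreover have "cos_coeff (2 * j) *\<^sub>R z ^ (2 * j) = of_real (bcoef (1/2) j) * (z\<^sup>2) ^ j" for j
  proof -
    have "fact (2 * j) = 4 ^ j * pochhammer (1/2) j * (fact j :: real)"
      using fact_double[of j, where 'a = real] by (simp add: power_mult)
    then have "cos_coeff (2 * j) = bcoef (1/2) j"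
      by (simp add: cos_coeff_def bcoef_def power_minus[of "1/4"] power_divide mult_ac)
    then show ?thesis by (simp add: power_mult scaleR_conv_of_real)
  qed
  ultimately show ?thesis unfolding bfun_def by (simp add: sums_iff)
qed

text \<open>The derivative of \<open>bfun_half\<close>, by the chain rule and
  \<open>DERIV_bfun\<close>.\<close>

lemma bfun_three_halves:
  "z * bfun (3/2) (z\<^sup>2) = sin z"
proof -
  have "(bfun (1/2) has_field_derivative - bfun (3/2) (z\<^sup>2) / 2) (at (z\<^sup>2))"
    using DERIV_bfun[of "1/2" "z\<^sup>2"] by simp
  moreover have "((\<lambda>z. z\<^sup>2) has_field_derivative 2 * z) (at z)"
    by (auto intro!: derivative_eq_intros)
  ultimately have "((\<lambda>z. bfun (1/2) (z\<^sup>2)) has_field_derivative - bfun (3/2) (z\<^sup>2) / 2 * (2 * z)) (at z)"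
    by (rule DERIV_chain2)
  then have "(cos has_field_derivative - bfun (3/2) (z\<^sup>2) / 2 * (2 * z)) (at z)" by (simp only: bfun_half)
  with DERIV_cos have "- sin z = - bfun (3/2) (z\<^sup>2) / 2 * (2 * z)" by (rule DERIV_unique)
  then show ?thesis by (simp add: mult.commute)
qed

text \<open>\<open>bfun_half\<close> at \<open>z = \<i> * x\<close>, where
  \<open>z^2 = - x^2\<close>.\<close>

lemma bmod_half: "bmod (1/2) (x\<^sup>2) = cosh x"
proof -
  have "complex_of_real (bmod (1/2) (x\<^sup>2)) = bfun (1/2) ((\<i> * of_real x)\<^sup>2)"
    using bfun_minus_of_real[of "1/2" "x\<^sup>2"] by (simp add: power_mult_distrib)
  also have "\<dots> = of_real (cosh x)" by (simp add: bfun_half cosh_field_def flip: cosh_conv_cos exp_of_real)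
  finally show ?thesis by (simp only: of_real_eq_iff)
qed

lemma bmod_three_halves: "x * bmod (3/2) (x\<^sup>2) = sinh x"
proof -
  have "complex_of_real (x * bmod (3/2) (x\<^sup>2)) = - \<i> * ((\<i> * of_real x) * bfun (3/2) ((\<i> * of_real x)\<^sup>2))"
    using bfun_minus_of_real[of "3/2" "x\<^sup>2"] by (simp add: power_mult_distrib) (simp add: complex_eq_iff)
  also have "\<dots> = sinh (of_real x)" unfolding bfun_three_halves sinh_conv_sin ..
  also have "\<dots> = of_real (sinh x)" by (simp add: sinh_field_def flip: exp_of_real)
  finally show ?thesis by (simp only: of_real_eq_iff)
qed

lemma infsum_bzeros_half:
  assumes "x > 0"
  shows "(\<Sum>\<^sub>\<infinity>a\<in>bzeros (1/2). 1 / (a + x\<^sup>2)) = tanh x / (2 * x)"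
proof -
  have "(\<Sum>\<^sub>\<infinity>a\<in>bzeros (1/2). 1 / (a + x\<^sup>2)) = bmod (3/2) (x\<^sup>2) / (2 * bmod (1/2) (x\<^sup>2))"
    using bzeros_partial_fractions(1)[of "1/2" "x\<^sup>2"] by simp
  also have "bmod (3/2) (x\<^sup>2) = sinh x / x" using bmod_three_halves[of x] assms by (simp add: field_simps)
  finally show ?thesis by (simp add: bmod_half tanh_def)
qed

text \<open>The numerator \<open>bmod (5/2)\<close> comes from cosh and sinh through the contiguous
  relation at parameter 1/2.\<close>

lemma infsum_bzeros_three_halves:
  assumes "x > 0"
  shows "(\<Sum>\<^sub>\<infinity>a\<in>bzeros (3/2). 1 / (a + x\<^sup>2)) = (coth x - 1 / x) / (2 * x)"
proof -
  have s: "bmod (3/2) (x\<^sup>2) = sinh x / x" using bmod_three_halves[of x] assms by (simp add: field_simps)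
  have "bmod (1/2) (x\<^sup>2) - bmod (3/2) (x\<^sup>2) = x\<^sup>2 * bmod (5/2) (x\<^sup>2) / 3"
    using bmod_contiguous[of "1/2" "x\<^sup>2"] by simp
  then have "cosh x - sinh x / x = x\<^sup>2 * bmod (5/2) (x\<^sup>2) / 3" by (simp only: bmod_half s)
  then have f: "bmod (5/2) (x\<^sup>2) = 3 * (cosh x - sinh x / x) / x\<^sup>2" using assms by (simp add: field_simps)
  have "(\<Sum>\<^sub>\<infinity>a\<in>bzeros (3/2). 1 / (a + x\<^sup>2)) = bmod (5/2) (x\<^sup>2) / (6 * bmod (3/2) (x\<^sup>2))"
    using bzeros_partial_fractions(1)[of "3/2" "x\<^sup>2"] by simp
  also have "\<dots> = (coth x - 1 / x) / (2 * x)"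
    unfolding f s coth_def using assms by (simp add: field_simps power2_eq_square)
  finally show ?thesis .
qed

text \<open>These are the zeros of \<open>sin z / z\<close>; the value 1 at z = 0 excludes n =
  0.\<close>

lemma bij_betw_bzeros_three_halves:
  "bij_betw (\<lambda>n. (real n * pi)\<^sup>2) {n. n \<ge> 1} (bzeros (3/2))"
  unfolding bij_betw_def
proof (intro conjI set_eqI iffI)
  show "inj_on (\<lambda>n. (real n * pi)\<^sup>2) {n. n \<ge> 1}"
    by (auto intro!: inj_onI simp: power_mult_distrib)
next
  fix y assume "y \<in> (\<lambda>n. (real n * pi)\<^sup>2) ` {n. n \<ge> 1}"
  then obtain n where n: "n \<ge> 1" "y = (real n * pi)\<^sup>2" by auto
  have "complex_of_real (real n * pi) * bfun (3/2) (of_real y) = of_real (sin (real n * pi))"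
    using bfun_three_halves[of "of_real (real n * pi)"] by (simp only: n(2) of_real_power sin_of_real)
  then have "bfun (3/2) (of_real y) = 0" using n by simp
  then show "y \<in> bzeros (3/2)" using n by (simp add: bzeros_def)
next
  fix y assume y: "y \<in> bzeros (3/2)"
  define s where "s = sqrt y"
  have s: "s > 0" "y = s\<^sup>2" using y by (auto simp: s_def bzeros_def)
  have "complex_of_real (sin s) = 0"
    using bfun_three_halves[of "of_real s"] y by (simp add: s(2) bzeros_def flip: sin_of_real)
  then have "sin s = 0" by (simp only: of_real_eq_0_iff)
  then obtain i :: int where i: "s = of_int i * pi" unfolding sin_zero_iff_int2 by blast
  then have "i > 0" using s(1) by (simp add: zero_less_mult_iff)
  then show "y \<in> (\<lambda>n. (real n * pi)\<^sup>2) ` {n. n \<ge> 1}"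
    using i s(2) by (intro image_eqI[of _ _ "nat i"]) auto
qed

lemma bij_betw_bzeros_half:
  "bij_betw (\<lambda>n. (real n * pi / 2)\<^sup>2) {n. n \<ge> 1 \<and> odd n} (bzeros (1/2))"
  unfolding bij_betw_def
proof (intro conjI set_eqI iffI)
  show "inj_on (\<lambda>n. (real n * pi / 2)\<^sup>2) {n. n \<ge> 1 \<and> odd n}"
    by (auto intro!: inj_onI simp: power_mult_distrib power_divide)
next
  fix y assume "y \<in> (\<lambda>n. (real n * pi / 2)\<^sup>2) ` {n. n \<ge> 1 \<and> odd n}"
  then obtain n where n: "n \<ge> 1" "odd n" "y = (real n * pi / 2)\<^sup>2" by auto
  have "cos (real n * pi / 2) = 0"
    unfolding cos_zero_iff_int using n(2) by (intro exI[of _ "int n"]) auto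
  then have "bfun (1/2) (of_real y) = 0"
    using bfun_half[of "of_real (real n * pi / 2)"] by (simp only: n(3) of_real_power cos_of_real of_real_0)
  then show "y \<in> bzeros (1/2)" using n by (simp add: bzeros_def)
next
  fix y assume y: "y \<in> bzeros (1/2)"
  define s where "s = sqrt y"
  have s: "s > 0" "y = s\<^sup>2" using y by (auto simp: s_def bzeros_def)
  have "complex_of_real (cos s) = 0"
    using bfun_half[of "of_real s"] y by (simp add: s(2) bzeros_def flip: cos_of_real)
  then have "cos s = 0" by (simp only: of_real_eq_0_iff)
  then obtain i :: int where i: "odd i" "s = of_int i * (pi / 2)" unfolding cos_zero_iff_int by blast
  have "of_int i * (pi / 2) > 0" using s(1) i(2) by (simp only:)
  then have "i > 0" by (simp add: zero_less_mult_iff)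
  then show "y \<in> (\<lambda>n. (real n * pi / 2)\<^sup>2) ` {n. n \<ge> 1 \<and> odd n}"
    unfolding s(2) i(2) using i(1) by (intro image_eqI[of _ _ "nat i"]) (auto simp: even_nat_iff)
qed

text \<open>Common to both special cases: when the zeros are \<open>(c * n)^2\<close>, multiplying
  the identity by \<open>c^4\<close> leaves fourth powers of integers.\<close>

lemma has_sum_bzeros_quartic:
  assumes \<alpha>: "\<alpha> > 0" and c: "c > 0" and bij: "bij_betw (\<lambda>n. (c * real n)\<^sup>2) A (bzeros \<alpha>)" and k: "k \<in> A" "k > 0"
    and T: "(\<Sum>\<^sub>\<infinity>a\<in>bzeros \<alpha>. 1 / (a + (c * real k)\<^sup>2)) = T"
  shows "((\<lambda>n. 1 / (real n ^ 4 - real k ^ 4)) has_sum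
     (- (c\<^sup>2 / (2 * (real k)\<^sup>2)) * T + (\<alpha> + 1) / (4 * real k ^ 4))) (A - {k})"
proof -
  define b where "b = (c * real k)\<^sup>2"
  have b: "b \<in> bzeros \<alpha>" using bij k by (auto simp: b_def bij_betw_def)
  have "((\<lambda>a. 1 / (a\<^sup>2 - b\<^sup>2)) has_sum (- 1 / (2 * b) * T + (\<alpha> + 1) / (4 * b\<^sup>2))) (bzeros \<alpha> - {b})"
    using bzeros_sum_diff_squares[OF \<alpha> b] T by (simp add: b_def)
  then have "((\<lambda>n. 1 / (((c * real n)\<^sup>2)\<^sup>2 - b\<^sup>2)) has_sum (- 1 / (2 * b) * T + (\<alpha> + 1) / (4 * b\<^sup>2))) (A - {k})"
    using has_sum_reindex_bij_betw[OF bij_betw_remove1[OF bij k(1)], of "\<lambda>a. 1 / (a\<^sup>2 - b\<^sup>2)"]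
    by (simp add: b_def)
  then have "((\<lambda>n. c ^ 4 * (1 / (((c * real n)\<^sup>2)\<^sup>2 - b\<^sup>2))) has_sum
      c ^ 4 * (- 1 / (2 * b) * T + (\<alpha> + 1) / (4 * b\<^sup>2))) (A - {k})"
    by (rule has_sum_cmult_right)
  moreover have "c ^ 4 * (1 / (((c * real n)\<^sup>2)\<^sup>2 - b\<^sup>2)) = 1 / (real n ^ 4 - real k ^ 4)" for n
  proof -
    have "((c * real n)\<^sup>2)\<^sup>2 - b\<^sup>2 = c ^ 4 * (real n ^ 4 - real k ^ 4)"
      by (simp add: b_def power_mult_distrib right_diff_distrib)
    then show ?thesis using c by simp
  qed
  moreover have "c ^ 4 * (- 1 / (2 * b) * T + (\<alpha> + 1) / (4 * b\<^sup>2))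
      = - (c\<^sup>2 / (2 * (real k)\<^sup>2)) * T + (\<alpha> + 1) / (4 * real k ^ 4)"
  proof -
    have e: "c ^ 4 * (1 / (2 * b)) = c\<^sup>2 / (2 * (real k)\<^sup>2)" "c ^ 4 / (4 * b\<^sup>2) = 1 / (4 * real k ^ 4)"
      using c k by (simp_all add: b_def power_mult_distrib field_simps power2_eq_square power4_eq_xxxx)
    have "c ^ 4 * (- 1 / (2 * b) * T + (\<alpha> + 1) / (4 * b\<^sup>2))
        = - (c ^ 4 * (1 / (2 * b))) * T + (\<alpha> + 1) * (c ^ 4 / (4 * b\<^sup>2))"
      by (simp add: algebra_simps)
    then show ?thesis unfolding e by simp
  qed
  ultimately show ?thesis by simp
qed

section \<open>Transport of the sums over zeros to the three stated identities\<close>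

theorem theorem1:
  shows "(\<forall>\<nu>::real. \<nu> > -1 \<longrightarrow> (\<forall>k::nat. k \<ge> 1 \<longrightarrow>
           (\<lambda>n. 1 / ((bessel_J_zero \<nu> n) ^ 2 + (bessel_J_zero \<nu> k) ^ 2)) summable_on {n. n \<ge> 1} \<and>
           ((\<lambda>n. 1 / ((bessel_J_zero \<nu> n) ^ 4 - (bessel_J_zero \<nu> k) ^ 4)) has_sum
             (- 1 / (2 * (bessel_J_zero \<nu> k) ^ 2) *
                (\<Sum>\<^sub>\<infinity>n\<in>{n. n \<ge> 1}. 1 / ((bessel_J_zero \<nu> n) ^ 2 + (bessel_J_zero \<nu> k) ^ 2))
              + (\<nu> + 2) / (4 * (bessel_J_zero \<nu> k) ^ 4)))
             {n. n \<ge> 1 \<and> n \<noteq> k}))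
       \<and> (\<forall>k::nat. k \<ge> 1 \<longrightarrow>
           ((\<lambda>n::nat. 1 / (real n ^ 4 - real k ^ 4)) has_sum
             (- pi / (4 * real k ^ 3) * coth (real k * pi) + 7 / (8 * real k ^ 4)))
             {n. n \<ge> 1 \<and> n \<noteq> k})
       \<and> (\<forall>k::nat. k \<ge> 1 \<and> odd k \<longrightarrow>
           ((\<lambda>n::nat. 1 / (real n ^ 4 - real k ^ 4)) has_sum
             (- pi / (8 * real k ^ 3) * tanh (real k * pi / 2) + 3 / (8 * real k ^ 4)))
             {n. n \<ge> 1 \<and> n \<noteq> k \<and> odd n})"
proof (intro conjI allI impI)
  fix \<nu> :: real and k :: nat
  assume \<nu>: "\<nu> > -1" and k: "k \<ge> 1"
  define j where "j = bessel_J_zero \<nu>"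
  define b where "b = (j k)\<^sup>2"
  have \<alpha>: "\<nu> + 1 > 0" using \<nu> by simp
  have bij: "bij_betw (\<lambda>n. (j n)\<^sup>2) {n. n \<ge> 1} (bzeros (\<nu> + 1))"
    unfolding j_def by (rule bij_betw_bessel_J_zero[OF \<nu>])
  then have b: "b \<in> bzeros (\<nu> + 1)" using k by (auto simp: b_def bij_betw_def)
  then have "b \<ge> 0" by (simp add: bzeros_def)
  have eq: "{n. n \<ge> 1 \<and> n \<noteq> k} = {n. n \<ge> 1} - {k}" by auto
  have j4: "j n ^ 4 = ((j n)\<^sup>2)\<^sup>2" for n by simp
  show "(\<lambda>n. 1 / ((bessel_J_zero \<nu> n)\<^sup>2 + (bessel_J_zero \<nu> k)\<^sup>2)) summable_on {n. n \<ge> 1}"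
    unfolding j_def[symmetric] b_def[symmetric]
    using summable_on_reindex_bij_betw[OF bij, of "\<lambda>a. 1 / (a + b)"]
      summable_inverse_bzeros_plus[OF \<alpha> \<open>b \<ge> 0\<close>] by simp
  have "((\<lambda>n. 1 / (((j n)\<^sup>2)\<^sup>2 - b\<^sup>2)) has_sum (- 1 / (2 * b) * (\<Sum>\<^sub>\<infinity>a\<in>bzeros (\<nu> + 1). 1 / (a + b))
      + (\<nu> + 1 + 1) / (4 * b\<^sup>2))) ({n. n \<ge> 1} - {k})"
    using has_sum_reindex_bij_betw[OF bij_betw_remove1[OF bij], of k "\<lambda>a. 1 / (a\<^sup>2 - b\<^sup>2)"]
      bzeros_sum_diff_squares[OF \<alpha> b] k by (simp add: b_def)
  moreover have "(\<Sum>\<^sub>\<infinity>n\<in>{n. n \<ge> 1}. 1 / ((j n)\<^sup>2 + b)) = (\<Sum>\<^sub>\<infinity>a\<in>bzeros (\<nu> + 1). 1 / (a + b))"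
    by (rule infsum_reindex_bij_betw[OF bij])
  moreover have "\<nu> + 1 + 1 = \<nu> + 2" by simp
  ultimately show "((\<lambda>n. 1 / ((bessel_J_zero \<nu> n) ^ 4 - (bessel_J_zero \<nu> k) ^ 4)) has_sum
             (- 1 / (2 * (bessel_J_zero \<nu> k) ^ 2) *
                (\<Sum>\<^sub>\<infinity>n\<in>{n. n \<ge> 1}. 1 / ((bessel_J_zero \<nu> n) ^ 2 + (bessel_J_zero \<nu> k) ^ 2))
              + (\<nu> + 2) / (4 * (bessel_J_zero \<nu> k) ^ 4)))
             {n. n \<ge> 1 \<and> n \<noteq> k}"
    unfolding j_def[symmetric] eq j4 b_def[symmetric] by (simp only:)
next
  fix k :: nat assume k: "k \<ge> 1"
  have eq: "{n. n \<ge> 1 \<and> n \<noteq> k} = {n. n \<ge> 1} - {k}" by auto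
  \<comment> \<open>Here \<open>c = pi\<close> and \<open>\<alpha> = 3/2\<close>. The part
    \<open>- 1 / (pi * k)\<close> beside coth contributes \<open>1/4\<close> and the last summand
    \<open>5/8\<close>, together \<open>7/8\<close>.\<close>
  have "((\<lambda>n. 1 / (real n ^ 4 - real k ^ 4)) has_sum
     (- (pi\<^sup>2 / (2 * (real k)\<^sup>2)) * ((coth (pi * real k) - 1 / (pi * real k)) / (2 * (pi * real k)))
        + (3 / 2 + 1) / (4 * real k ^ 4))) ({n. n \<ge> 1} - {k})"
    using bij_betw_bzeros_three_halves k infsum_bzeros_three_halves[of "pi * real k"]
    by (intro has_sum_bzeros_quartic) (auto simp: mult.commute)
  also have "- (pi\<^sup>2 / (2 * (real k)\<^sup>2)) * ((coth (pi * real k) - 1 / (pi * real k)) / (2 * (pi * real k)))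
        + (3 / 2 + 1) / (4 * real k ^ 4) = - pi / (4 * real k ^ 3) * coth (real k * pi) + 7 / (8 * real k ^ 4)"
    using k by (simp add: field_simps power2_eq_square power3_eq_cube power4_eq_xxxx)
  finally show "((\<lambda>n::nat. 1 / (real n ^ 4 - real k ^ 4)) has_sum
             (- pi / (4 * real k ^ 3) * coth (real k * pi) + 7 / (8 * real k ^ 4)))
             {n. n \<ge> 1 \<and> n \<noteq> k}" unfolding eq .
next
  fix k :: nat assume k: "k \<ge> 1 \<and> odd k"
  have eq: "{n. n \<ge> 1 \<and> n \<noteq> k \<and> odd n} = {n. n \<ge> 1 \<and> odd n} - {k}" by auto
  \<comment> \<open>Here \<open>c = pi / 2\<close> and \<open>\<alpha> = 1/2\<close>, and
    \<open>(\<alpha> + 1) / 4 = 3/8\<close>.\<close>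
  have "((\<lambda>n. 1 / (real n ^ 4 - real k ^ 4)) has_sum
     (- ((pi / 2)\<^sup>2 / (2 * (real k)\<^sup>2)) * (tanh (pi / 2 * real k) / (2 * (pi / 2 * real k)))
        + (1 / 2 + 1) / (4 * real k ^ 4))) ({n. n \<ge> 1 \<and> odd n} - {k})"
    using bij_betw_bzeros_half k infsum_bzeros_half[of "pi / 2 * real k"]
    by (intro has_sum_bzeros_quartic) (auto simp: mult.commute)
  also have "- ((pi / 2)\<^sup>2 / (2 * (real k)\<^sup>2)) * (tanh (pi / 2 * real k) / (2 * (pi / 2 * real k)))
        + (1 / 2 + 1) / (4 * real k ^ 4) = - pi / (8 * real k ^ 3) * tanh (real k * pi / 2) + 3 / (8 * real k ^ 4)"
    using k by (simp add: field_simps power2_eq_square power3_eq_cube power4_eq_xxxx)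
  finally show "((\<lambda>n::nat. 1 / (real n ^ 4 - real k ^ 4)) has_sum
             (- pi / (8 * real k ^ 3) * tanh (real k * pi / 2) + 3 / (8 * real k ^ 4)))
             {n. n \<ge> 1 \<and> n \<noteq> k \<and> odd n}" unfolding eq .
qed

end
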